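(* Let $n\ge 1$, let $K_0\subset K_1\subset\cdots\subset K_n$ be a tower of subfields (equalities allowed) of a finite field $K=\mathbb{F}_q$, let $d_i=|K_i|$, and let $\mathcal{X}=[K_0\times\cdots\times K_n]\subset\mathbb{P}^n$ be the associated projective nested product of fields. Let $\mathrm{reg}(\delta_{\mathcal X})$ be the regularity index of the minimum distance function $\delta_{\mathcal X}$ and $\mathrm{reg}(H_{\mathcal X})$ the regularity index of the Hilbert function $H_{\mathcal X}$. For $0\le j\le n$ let $[e_j]\in\mathbb{P}^n$ be the point defined by the $j$-th unit vector. Put $$m_n=\min\Big\{m\in\mathbb{N} : m(d_n-1)>\sum_{i=1}^{n-1}(d_i-1)\Big\}.$$ Then: (a) $\mathrm{reg}(\delta_{\mathcal X})=m_n(d_n-1)+1$. (b) For every $P\in\mathcal{X}$, $\mathrm{v}_P(I_{\mathcal X})\in\{\mathrm{v}_{[e_0]}(I_{\mathcal X}),\ldots,\mathrm{v}_{[e_n]}(I_{\mathcal X})\}$. (c) $1+\sum_{i=1}^n(d_i-1)=\mathrm{reg}(H_{\mathcal X})=\mathrm{v}_{[e_0]}(I_{\mathcal X})\ge \mathrm{v}_{[e_1]}(I_{\mathcal X})\ge\cdots\ge \mathrm{v}_{[e_n]}(I_{\mathcal X})=m_n(d_n-1)+1=\mathrm{reg}(\delta_{\mathcal X})$.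
   Context: $S=K[t_0,\ldots,t_n]=\bigoplus_{d\ge0}S_d$ has the standard grading, and $\mathbb{P}^n$ is the $n$-dimensional projective space over $K$. The projective nested product of fields is $\mathcal{X}=[K_0\times\cdots\times K_n]:=\{(a_0:\cdots:a_n)\in\mathbb{P}^n : a_i\in K_i \text{ for all } i\}$. Points are written in standard representation (first nonzero entry from the left equal to $1$); call them $P_1,\ldots,P_m$. For $d\ge0$, $C_{\mathcal X}(d)\subset K^m$ is the image of $S_d\to K^{m}$, $f\mapsto(f(P_1),\ldots,f(P_m))$; $\delta_{\mathcal X}(d)$ is the minimum number of nonzero entries of a nonzero vector of $C_{\mathcal X}(d)$; and $\mathrm{reg}(\delta_{\mathcal X}):=\min\{d\ge0:\delta_{\mathcal X}(d)=1\}$. $I_{\mathcal X}\subset S$ is the ideal generated by the homogeneous polynomials vanishing at all points of $\mathcal{X}$, and $I_P$ is the same for a single point $P$. $H_{\mathcal X}(d):=\dim_K(S_d/(I_{\mathcal X}\cap S_d))$, and $\mathrm{reg}(H_{\mathcal X})$ is the least $r\ge0$ with $H_{\mathcal X}(d)=|\mathcal X|$ for all $d\ge r$. For $P\in\mathcal{X}$, the local v-number is $\mathrm{v}_P(I_{\mathcal X}):=\min\{d\ge0:\exists f\in S_d \text{ with } (I_{\mathcal X}:f)=I_P\}$, where $(I_{\mathcal X}:f)=\{g\in S: gf\in I_{\mathcal X}\}$. Empty sums are $0$. Coordinates of vectors are indexed from $0$ to $n$. *)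

theory Defs
  imports
    "HOL-Library.Poly_Mapping"
    "HOL-Algebra.Subrings"
    "HOL-Algebra.Ideal"
    "Jordan_Normal_Form.VS_Connect"
begin

section \<open>The graded polynomial ring\<close>

text \<open>A polynomial is a finitely supported map from exponent vectors to coefficients; the
  exponent vector \<open>m\<close> stands for the monomial \<open>\<Prod>i. t\<^sub>i ^ m i\<close>.\<close>

type_synonym 'k mpoly = "(nat \<Rightarrow>\<^sub>0 nat) \<Rightarrow>\<^sub>0 'k"

definition mono_deg :: "(nat \<Rightarrow>\<^sub>0 nat) \<Rightarrow> nat" where
  "mono_deg m = (\<Sum>i\<in>Poly_Mapping.keys m. Poly_Mapping.lookup m i)"

text \<open>The algebra \<open>S = K[t\<^sub>0, \<dots>, t\<^sub>n]\<close>, where \<open>K\<close> is the whole type \<open>'k\<close>; the constant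
  polynomial \<open>c\<close> is \<open>Poly_Mapping.single 0 c\<close>.\<close>

definition poly_alg :: "nat \<Rightarrow> ('k::field, 'k mpoly) module" where
  "poly_alg n =
    \<lparr>carrier = {f. \<forall>m\<in>Poly_Mapping.keys f. Poly_Mapping.keys m \<subseteq> {..n}},
     mult = (*), one = 1, zero = 0, add = (+),
     smult = (\<lambda>c f. Poly_Mapping.single 0 c * f)\<rparr>"

definition hom_part :: "nat \<Rightarrow> nat \<Rightarrow> 'k::field mpoly set" where
  "hom_part n d = {f \<in> carrier (poly_alg n). \<forall>m\<in>Poly_Mapping.keys f. mono_deg m = d}"

definition peval :: "(nat \<Rightarrow> 'k::field) \<Rightarrow> 'k mpoly \<Rightarrow> 'k" where
  "peval x f = (\<Sum>m\<in>Poly_Mapping.keys f.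
    Poly_Mapping.lookup f m * (\<Prod>i\<in>Poly_Mapping.keys m. x i ^ Poly_Mapping.lookup m i))"

definition colon_ideal :: "nat \<Rightarrow> 'k::field mpoly set \<Rightarrow> 'k mpoly \<Rightarrow> 'k mpoly set" where
  "colon_ideal n I f = {g \<in> carrier (poly_alg n). g * f \<in> I}"


section \<open>Projective space\<close>

text \<open>Vectors of \<open>K ^ (n+1)\<close> are functions vanishing beyond index \<open>n\<close>; a projective point is
  the set of all its homogeneous coordinate vectors.\<close>

definition proj_point :: "(nat \<Rightarrow> 'k::field) \<Rightarrow> (nat \<Rightarrow> 'k) set" where
  "proj_point x = {(\<lambda>i. c * x i) |c. c \<noteq> 0}"

definition proj_space :: "nat \<Rightarrow> (nat \<Rightarrow> 'k::field) set set" where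
  "proj_space n = proj_point ` {x. (\<forall>i>n. x i = 0) \<and> (\<exists>i\<le>n. x i \<noteq> 0)}"

definition std_rep :: "(nat \<Rightarrow> 'k::field) set \<Rightarrow> nat \<Rightarrow> 'k" where
  "std_rep P = (THE x. x \<in> P \<and> x (LEAST i. x i \<noteq> 0) = 1)"

definition unit_point :: "nat \<Rightarrow> (nat \<Rightarrow> 'k::field) set" where
  "unit_point j = proj_point (\<lambda>i. if i = j then 1 else 0)"

definition nested_product :: "nat \<Rightarrow> (nat \<Rightarrow> 'k::field set) \<Rightarrow> (nat \<Rightarrow> 'k) set set" where
  "nested_product n F = {P \<in> proj_space n. \<exists>a\<in>P. \<forall>i\<le>n. a i \<in> F i}"


section \<open>Projective Reed-Muller-type codes and their minimum distance\<close>

text \<open>The points of \<open>X\<close> are not numbered: a vector of \<open>K ^ card X\<close> is an extensional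
  function on \<open>X\<close>.\<close>

definition code :: "nat \<Rightarrow> (nat \<Rightarrow> 'k::field) set set \<Rightarrow> nat \<Rightarrow> ((nat \<Rightarrow> 'k) set \<Rightarrow> 'k) set" where
  "code n X d = (\<lambda>f. \<lambda>P\<in>X. peval (std_rep P) f) ` hom_part n d"

definition min_dist :: "nat \<Rightarrow> (nat \<Rightarrow> 'k::field) set set \<Rightarrow> nat \<Rightarrow> nat" where
  "min_dist n X d =
    (LEAST w. \<exists>c\<in>code n X d. (\<exists>P\<in>X. c P \<noteq> 0) \<and> w = card {P \<in> X. c P \<noteq> 0})"

definition reg_min_dist :: "nat \<Rightarrow> (nat \<Rightarrow> 'k::field) set set \<Rightarrow> nat" where
  "reg_min_dist n X = (LEAST d. min_dist n X d = 1)"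


section \<open>Vanishing ideals, Hilbert functions and v-numbers\<close>

definition vanishing_ideal :: "nat \<Rightarrow> (nat \<Rightarrow> 'k::field) set set \<Rightarrow> 'k mpoly set" where
  "vanishing_ideal n X =
    genideal (poly_alg n) {f. (\<exists>d. f \<in> hom_part n d) \<and> (\<forall>P\<in>X. \<forall>x\<in>P. peval x f = 0)}"

text \<open>The quotient vector space \<open>V / W\<close>, whose elements are the cosets of \<open>W\<close>. The fields
  \<open>mult\<close> and \<open>one\<close> of the record play no role for modules.\<close>

definition quotient_space :: "('k, 'v, 'm) module_scheme \<Rightarrow> 'v set \<Rightarrow> ('k, 'v set) module" where
  "quotient_space V W =
    \<lparr>carrier = a_rcosets\<^bsub>V\<^esub> W,
     mult = (\<lambda>_ _. W), one = W, zero = W, add = set_add V,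
     smult = (\<lambda>c A. \<Union>x\<in>A. W +>\<^bsub>V\<^esub> (c \<odot>\<^bsub>V\<^esub> x))\<rparr>"

definition hilbert_fun :: "nat \<Rightarrow> (nat \<Rightarrow> 'k::field) set set \<Rightarrow> nat \<Rightarrow> nat" where
  "hilbert_fun n X d =
    vectorspace.dim class_ring
      (quotient_space ((poly_alg n)\<lparr>carrier := hom_part n d\<rparr>)
        (vanishing_ideal n X \<inter> hom_part n d))"

definition reg_hilbert :: "nat \<Rightarrow> (nat \<Rightarrow> 'k::field) set set \<Rightarrow> nat" where
  "reg_hilbert n X = (LEAST r. \<forall>d\<ge>r. hilbert_fun n X d = card X)"

definition v_number ::
    "nat \<Rightarrow> (nat \<Rightarrow> 'k::field) set set \<Rightarrow> (nat \<Rightarrow> 'k) set \<Rightarrow> nat" where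
  "v_number n X P =
    (LEAST d. \<exists>f\<in>hom_part n d.
      colon_ideal n (vanishing_ideal n X) f = vanishing_ideal n {P})"

end

theory Submission
  imports Defs
begin

text \<open>Write \<open>w\<^sub>i = d\<^sub>i - 1\<close> and \<open>W = w\<^sub>0 + \<dots> + w\<^sub>n\<close>; since the fields form a tower,
  \<open>w\<^sub>i\<close> divides \<open>w\<^sub>j\<close> for \<open>i \<le> j\<close>. The local v-number of a point is the least degree of
  a form vanishing at all the other points but not there. Hence \<open>reg(\<delta>)\<close> is the minimum and
  \<open>reg(H)\<close> the maximum of the local v-numbers. Triangular translations preserve the point set
  and carry \<open>[e\<^sub>k]\<close> to any point whose first nonzero coordinate has index \<open>k\<close>, so only the
  unit points matter. On the affine grid, a form of degree \<open>d\<close> that is an indicator of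
  \<open>[e\<^sub>k]\<close> coincides up to a scalar with \<open>t\<^sub>k ^ r * (\<Prod>i \<noteq> k. 1 - t\<^sub>i ^ w\<^sub>i)\<close>, where
  \<open>1 \<le> r \<le> w\<^sub>k\<close> and \<open>r\<close> is congruent to \<open>d\<close> modulo \<open>w\<^sub>k\<close>. This forces
  \<open>d \<ge> r + W - w\<^sub>k\<close>; conversely the divisibilities allow the product to be homogenised
  whenever this holds. The least such degree is one plus the largest multiple of \<open>w\<^sub>k\<close>
  below \<open>W\<close>, which decreases with \<open>k\<close>.\<close>

section \<open>Evaluation of polynomials\<close>

definition mono_eval :: "(nat \<Rightarrow> 'a::comm_ring_1) \<Rightarrow> (nat \<Rightarrow>\<^sub>0 nat) \<Rightarrow> 'a" where
  "mono_eval x m = (\<Prod>i\<in>Poly_Mapping.keys m. x i ^ Poly_Mapping.lookup m i)"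

text \<open>Coefficients pass through \<open>h\<close> so that one set of lemmas serves values in
  the field (\<open>h\<close> the identity, giving \<open>peval\<close>) and values in the
  polynomial ring over it (\<open>h\<close> the embedding of constants, giving
  \<open>hom_eval\<close>).\<close>

definition gen_eval :: "('k::field \<Rightarrow> 'a::comm_ring_1) \<Rightarrow> (nat \<Rightarrow> 'a) \<Rightarrow> 'k mpoly \<Rightarrow> 'a" where
  "gen_eval h x f = (\<Sum>m\<in>Poly_Mapping.keys f. h (Poly_Mapping.lookup f m) * mono_eval x m)"

lemma mono_eval_superset:
  assumes "finite A" "Poly_Mapping.keys m \<subseteq> A"
  shows "mono_eval x m = (\<Prod>i\<in>A. x i ^ Poly_Mapping.lookup m i)"
  unfolding mono_eval_def using assms
  by (intro prod.mono_neutral_left) (auto simp: in_keys_iff)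

lemma mono_deg_superset:
  assumes "finite A" "Poly_Mapping.keys m \<subseteq> A"
  shows "mono_deg m = (\<Sum>i\<in>A. Poly_Mapping.lookup m i)"
  unfolding mono_deg_def using assms
  by (intro sum.mono_neutral_left) (auto simp: in_keys_iff)

lemma mono_eval_add: "mono_eval x (m + m') = mono_eval x m * mono_eval x m'"
proof -
  let ?A = "Poly_Mapping.keys m \<union> Poly_Mapping.keys m'"
  have "Poly_Mapping.keys (m + m') \<subseteq> ?A" by (rule keys_add)
  then show ?thesis
    by (simp add: mono_eval_superset[of ?A] lookup_add power_add prod.distrib)
qed

lemma mono_deg_add: "mono_deg (m + m') = mono_deg m + mono_deg m'"
proof -
  let ?A = "Poly_Mapping.keys m \<union> Poly_Mapping.keys m'"
  have "Poly_Mapping.keys (m + m') \<subseteq> ?A" by (rule keys_add)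
  then show ?thesis
    by (simp add: mono_deg_superset[of ?A] lookup_add sum.distrib)
qed

lemma mono_eval_zero [simp]: "mono_eval x 0 = 1"
  by (simp add: mono_eval_def)

lemma mono_deg_zero [simp]: "mono_deg 0 = 0"
  by (simp add: mono_deg_def)

lemma mpoly_eq_sum: "f = (\<Sum>m\<in>Poly_Mapping.keys f. Poly_Mapping.single m (Poly_Mapping.lookup f m))"
proof (rule poly_mapping_eqI)
  fix k
  show "Poly_Mapping.lookup f k = Poly_Mapping.lookup
    (\<Sum>m\<in>Poly_Mapping.keys f. Poly_Mapping.single m (Poly_Mapping.lookup f m)) k"
    by (simp add: lookup_sum lookup_single when_def sum.delta in_keys_iff)
qed

lemma peval_eq_gen_eval: "peval x f = gen_eval (\<lambda>c. c) x f"
  by (simp add: peval_def gen_eval_def mono_eval_def)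

context
  fixes h :: "'k::field \<Rightarrow> 'a::comm_ring_1"
  assumes h0 [simp]: "h 0 = 0" and h_add: "\<And>a b. h (a + b) = h a + h b"
    and h_mult: "\<And>a b. h (a * b) = h a * h b"
begin

lemma gen_eval_superset:
  assumes "finite A" "Poly_Mapping.keys f \<subseteq> A"
  shows "gen_eval h x f = (\<Sum>m\<in>A. h (Poly_Mapping.lookup f m) * mono_eval x m)"
  unfolding gen_eval_def using assms
  by (intro sum.mono_neutral_left) (auto simp: in_keys_iff)

lemma gen_eval_single: "gen_eval h x (Poly_Mapping.single m c) = h c * mono_eval x m"
  by (simp add: gen_eval_superset[of "{m}"])

lemma gen_eval_add: "gen_eval h x (f + g) = gen_eval h x f + gen_eval h x g"
proof -
  let ?A = "Poly_Mapping.keys f \<union> Poly_Mapping.keys g"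
  have "Poly_Mapping.keys (f + g) \<subseteq> ?A" by (rule keys_add)
  then show ?thesis
    by (simp add: gen_eval_superset[of ?A] lookup_add h_add ring_distribs sum.distrib)
qed

lemma gen_eval_zero: "gen_eval h x 0 = 0"
  by (simp add: gen_eval_def)

lemma gen_eval_sum: "gen_eval h x (\<Sum>i\<in>I. f i) = (\<Sum>i\<in>I. gen_eval h x (f i))"
  by (induction I rule: infinite_finite_induct) (auto simp: gen_eval_zero gen_eval_add)

lemma gen_eval_mult: "gen_eval h x (f * g) = gen_eval h x f * gen_eval h x g"
proof -
  let ?s = "\<lambda>f m. Poly_Mapping.single m (Poly_Mapping.lookup f m)"
  have "gen_eval h x (f * g) =
    gen_eval h x ((\<Sum>m\<in>Poly_Mapping.keys f. ?s f m) * (\<Sum>m\<in>Poly_Mapping.keys g. ?s g m))"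
    using mpoly_eq_sum[of f] mpoly_eq_sum[of g] by simp
  also have "\<dots> = (\<Sum>m\<in>Poly_Mapping.keys f. \<Sum>m'\<in>Poly_Mapping.keys g.
      (h (Poly_Mapping.lookup f m) * mono_eval x m) * (h (Poly_Mapping.lookup g m') * mono_eval x m'))"
    by (simp add: sum_product gen_eval_sum mult_single gen_eval_single h_mult mono_eval_add mult_ac)
  also have "\<dots> = gen_eval h x f * gen_eval h x g"
    by (simp add: sum_product gen_eval_superset[OF _ order_refl])
  finally show ?thesis .
qed

end

lemma peval_zero [simp]: "peval x 0 = 0"
  and peval_single: "peval x (Poly_Mapping.single m c) = c * mono_eval x m"
  and peval_add: "peval x (f + g) = peval x f + peval x g"
  and peval_mult: "peval x (f * g) = peval x f * peval x g"
  and peval_sum: "peval x (\<Sum>i\<in>I. p i) = (\<Sum>i\<in>I. peval x (p i))"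
  unfolding peval_eq_gen_eval
  by (simp_all add: gen_eval_zero gen_eval_single gen_eval_add gen_eval_mult gen_eval_sum)

lemma peval_eq_sum: "peval x f = (\<Sum>m\<in>Poly_Mapping.keys f. Poly_Mapping.lookup f m * mono_eval x m)"
  by (simp add: peval_def mono_eval_def)

section \<open>The graded algebra and its homogeneous vanishing ideals\<close>

lemma mpoly_carrier: "f \<in> carrier (poly_alg n) \<longleftrightarrow> (\<forall>m\<in>Poly_Mapping.keys f. Poly_Mapping.keys m \<subseteq> {..n})"
  by (simp add: poly_alg_def)

lemma carrier_add: "f \<in> carrier (poly_alg n) \<Longrightarrow> g \<in> carrier (poly_alg n) \<Longrightarrow> f + g \<in> carrier (poly_alg n)"
  using keys_add[of f g] by (fastforce simp: mpoly_carrier)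

lemma carrier_mult: "f \<in> carrier (poly_alg n) \<Longrightarrow> g \<in> carrier (poly_alg n) \<Longrightarrow> f * g \<in> carrier (poly_alg n)"
proof (unfold mpoly_carrier, intro ballI)
  fix m assume f: "\<forall>m\<in>Poly_Mapping.keys f. Poly_Mapping.keys m \<subseteq> {..n}"
    and g: "\<forall>m\<in>Poly_Mapping.keys g. Poly_Mapping.keys m \<subseteq> {..n}"
    and "m \<in> Poly_Mapping.keys (f * g)"
  then obtain a b where "m = a + b" "a \<in> Poly_Mapping.keys f" "b \<in> Poly_Mapping.keys g"
    using keys_mult[of f g] by blast
  then show "Poly_Mapping.keys m \<subseteq> {..n}" using f g keys_add[of a b] by blast
qed

lemma carrier_single: "Poly_Mapping.keys m \<subseteq> {..n} \<Longrightarrow> Poly_Mapping.single m c \<in> carrier (poly_alg n)"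
  by (simp add: mpoly_carrier)

lemma carrier_zero: "0 \<in> carrier (poly_alg n)" and carrier_one: "1 \<in> carrier (poly_alg n)"
  and carrier_uminus: "f \<in> carrier (poly_alg n) \<Longrightarrow> - f \<in> carrier (poly_alg n)"
  by (simp_all add: mpoly_carrier in_keys_iff)

lemma poly_alg_sel:
  "add (poly_alg n) = (+)" "mult (poly_alg n) = (*)" "zero (poly_alg n) = 0" "one (poly_alg n) = 1"
  "module.smult (poly_alg n) = (\<lambda>c f. Poly_Mapping.single 0 c * f)"
  by (simp_all add: poly_alg_def)

lemma poly_alg_cring: "cring (poly_alg n)"
proof (intro cringI abelian_groupI comm_monoidI)
  fix x :: "'a mpoly" assume x: "x \<in> carrier (poly_alg n)"
  show "\<exists>y\<in>carrier (poly_alg n). y \<oplus>\<^bsub>poly_alg n\<^esub> x = \<zero>\<^bsub>poly_alg n\<^esub>"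
    using x by (intro bexI[of _ "- x"]) (auto simp: poly_alg_sel carrier_uminus)
qed (auto simp: poly_alg_sel carrier_add carrier_mult carrier_zero carrier_one algebra_simps)

lemma poly_alg_ring: "ring (poly_alg n)"
  using poly_alg_cring cring_def by blast

lemma ideal_poly_algI:
  assumes "I \<subseteq> carrier (poly_alg n)" "0 \<in> I" "\<And>f g. f \<in> I \<Longrightarrow> g \<in> I \<Longrightarrow> f + g \<in> I"
    "\<And>f g. f \<in> I \<Longrightarrow> g \<in> carrier (poly_alg n) \<Longrightarrow> g * f \<in> I"
  shows "ideal I (poly_alg n)"
proof (intro idealI poly_alg_ring)
  interpret cring "poly_alg n" by (rule poly_alg_cring)
  have m: "- f \<in> I" if "f \<in> I" for f
    using assms(4)[OF that carrier_uminus[OF carrier_one]] by simp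
  have inv: "\<ominus>\<^bsub>poly_alg n\<^esub> f = - f" if "f \<in> I" for f
    using that m assms(1) by (intro minus_equality) (auto simp: poly_alg_sel)
  show "subgroup I (add_monoid (poly_alg n))"
    using assms m
    by (intro group.subgroupI add.group_axioms)
      (auto simp: poly_alg_sel inv[unfolded a_inv_def poly_alg_sel])
qed (use assms in \<open>auto simp: poly_alg_sel mult.commute\<close>)

lemma genideal_sum:
  assumes "S \<subseteq> carrier (poly_alg n)" "\<And>i. i \<in> A \<Longrightarrow> f i \<in> S"
  shows "(\<Sum>i\<in>A. f i) \<in> genideal (poly_alg n) S"
proof -
  interpret R: ring "poly_alg n" by (rule poly_alg_ring)
  interpret I: ideal "genideal (poly_alg n) S" "poly_alg n"
    by (rule R.genideal_ideal[OF assms(1)])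
  from assms(2) show ?thesis
  proof (induction A rule: infinite_finite_induct)
    case (insert a A)
    then show ?case
      using I.a_closed[of "f a" "\<Sum>i\<in>A. f i"] R.genideal_self[OF assms(1)]
      by (auto simp: poly_alg_sel)
  qed (use I.zero_closed in \<open>auto simp: poly_alg_sel\<close>)
qed

lemma hom_part_zero: "0 \<in> hom_part n d"
  by (simp add: hom_part_def carrier_zero)

lemma hom_part_add: "f \<in> hom_part n d \<Longrightarrow> g \<in> hom_part n d \<Longrightarrow> f + g \<in> hom_part n d"
  using keys_add[of f g] by (auto simp: hom_part_def carrier_add)

lemma hom_part_sum: "(\<And>i. i \<in> A \<Longrightarrow> f i \<in> hom_part n d) \<Longrightarrow> (\<Sum>i\<in>A. f i) \<in> hom_part n d"
  by (induction A rule: infinite_finite_induct) (auto simp: hom_part_zero hom_part_add)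

lemma hom_part_mult: "f \<in> hom_part n d \<Longrightarrow> g \<in> hom_part n e \<Longrightarrow> f * g \<in> hom_part n (d + e)"
proof -
  assume f: "f \<in> hom_part n d" and g: "g \<in> hom_part n e"
  have "mono_deg m = d + e" if "m \<in> Poly_Mapping.keys (f * g)" for m
    using keys_mult[of f g] that f g by (auto simp: hom_part_def mono_deg_add)
  then show ?thesis using f g by (auto simp: hom_part_def carrier_mult)
qed

lemma hom_part_single:
  "Poly_Mapping.keys m \<subseteq> {..n} \<Longrightarrow> mono_deg m = d \<Longrightarrow> Poly_Mapping.single m c \<in> hom_part n d"
  by (simp add: hom_part_def carrier_single)

lemma hom_part_smult: "f \<in> hom_part n d \<Longrightarrow> Poly_Mapping.single 0 c * f \<in> hom_part n d"
  using hom_part_mult[OF hom_part_single[of 0 n 0 c], of f d] by simp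

lemma peval_smult: "peval x (Poly_Mapping.single 0 c * f) = c * peval x f"
  by (simp add: peval_mult peval_single)

definition hcomp :: "nat \<Rightarrow> 'k::field mpoly \<Rightarrow> 'k mpoly" where
  "hcomp d f = (\<Sum>m\<in>{m \<in> Poly_Mapping.keys f. mono_deg m = d}.
    Poly_Mapping.single m (Poly_Mapping.lookup f m))"

text \<open>Evaluation along the line through \<open>x\<close>, that is at \<open>T x\<close> with a new variable
  \<open>T\<close>. As a ring homomorphism that separates the homogeneous components it turns
  \<^const>\<open>vanishing_ideal\<close> into a common kernel.\<close>

definition hom_eval :: "(nat \<Rightarrow> 'k::field) \<Rightarrow> 'k mpoly \<Rightarrow> 'k poly" where
  "hom_eval x = gen_eval (\<lambda>c. [:c:]) (\<lambda>i. [:0, x i:])"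

lemma sum_hcomp: "(\<Sum>d\<in>mono_deg ` Poly_Mapping.keys f. hcomp d f) = f"
  using sum.image_gen[of "Poly_Mapping.keys f"
      "\<lambda>m. Poly_Mapping.single m (Poly_Mapping.lookup f m)" mono_deg]
  by (simp add: hcomp_def flip: mpoly_eq_sum)

lemma hcomp_hom_part: "f \<in> carrier (poly_alg n) \<Longrightarrow> hcomp d f \<in> hom_part n d"
  unfolding hcomp_def by (intro hom_part_sum) (auto intro!: hom_part_single simp: mpoly_carrier)

lemma mono_eval_hom: "mono_eval (\<lambda>i. [:0, x i:]) m = Polynomial.monom (mono_eval x m) (mono_deg m)"
proof -
  have "[:0, x i:] = Polynomial.monom (x i) 1" for i
    by (simp add: monom_Suc monom_0)
  moreover have "(\<Prod>i\<in>A. Polynomial.monom (a i) (e i)) = Polynomial.monom (\<Prod>i\<in>A. a i) (\<Sum>i\<in>A. e i)"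
    for A :: "nat set" and a :: "nat \<Rightarrow> 'a" and e
    by (induction A rule: infinite_finite_induct) (simp_all add: mult_monom monom_0 one_pCons)
  ultimately show ?thesis
    by (simp add: mono_eval_def mono_deg_def monom_power)
qed

lemma
  shows hom_eval_add: "hom_eval x (f + g) = hom_eval x f + hom_eval x g"
    and hom_eval_mult: "hom_eval x (f * g) = hom_eval x f * hom_eval x g"
    and hom_eval_zero: "hom_eval x 0 = 0"
  unfolding hom_eval_def by (simp_all add: gen_eval_zero gen_eval_add gen_eval_mult)

lemma hom_eval_eq_sum: "hom_eval x f = (\<Sum>m\<in>Poly_Mapping.keys f.
      Polynomial.monom (Poly_Mapping.lookup f m * mono_eval x m) (mono_deg m))"
  by (simp add: hom_eval_def gen_eval_def mono_eval_hom smult_monom)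

lemma coeff_hom_eval: "coeff (hom_eval x f) d = peval x (hcomp d f)"
  by (simp add: hom_eval_eq_sum hcomp_def coeff_sum peval_sum peval_single
      sum.inter_filter[symmetric])

lemma hom_eval_hom_part: "f \<in> hom_part n d \<Longrightarrow> hom_eval x f = Polynomial.monom (peval x f) d"
  by (simp add: hom_eval_eq_sum hom_part_def peval_eq_sum flip: monom_sum)

text \<open>On a form of degree \<open>d\<close>, \<open>hom_eval x\<close> is the value at
  \<open>x\<close> times the \<open>d\<close>-th power of the new variable, so the common kernel is
  an ideal containing the generators. Conversely, the coefficients of \<open>hom_eval x f\<close>
  are the values at \<open>x\<close> of the homogeneous components of \<open>f\<close>; if they all
  vanish, each component is a generator and \<open>f\<close> is their sum.\<close>

lemma vanishing_ideal_eq: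
  "vanishing_ideal n X = {f \<in> carrier (poly_alg n). \<forall>P\<in>X. \<forall>x\<in>P. hom_eval x f = 0}" (is "_ = ?J")
proof
  interpret R: ring "poly_alg n" by (rule poly_alg_ring)
  let ?G = "{f. (\<exists>d. f \<in> hom_part n d) \<and> (\<forall>P\<in>X. \<forall>x\<in>P. peval x f = 0)}"
  show "vanishing_ideal n X \<subseteq> ?J"
    unfolding vanishing_ideal_def
  proof (rule R.genideal_minimal)
    show "ideal ?J (poly_alg n)"
      by (rule ideal_poly_algI)
        (auto simp: carrier_zero carrier_add carrier_mult hom_eval_zero hom_eval_add hom_eval_mult)
    show "?G \<subseteq> ?J"
      by (auto simp: hom_eval_hom_part) (auto simp: hom_part_def)
  qed
  show "?J \<subseteq> vanishing_ideal n X"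
  proof
    fix f assume f: "f \<in> ?J"
    have "(\<Sum>d\<in>mono_deg ` Poly_Mapping.keys f. hcomp d f) \<in> genideal (poly_alg n) ?G"
    proof (rule genideal_sum)
      show "?G \<subseteq> carrier (poly_alg n)" by (auto simp: hom_part_def)
      show "hcomp d f \<in> ?G" for d
        using f hcomp_hom_part[of f n d] by (auto simp flip: coeff_hom_eval)
    qed
    then show "f \<in> vanishing_ideal n X" by (simp add: vanishing_ideal_def sum_hcomp)
  qed
qed

section \<open>Finite subfields\<close>

lemma subfield_class_ring:
  fixes F :: "'k::field set"
  assumes "subfield F class_ring"
  shows "0 \<in> F" "1 \<in> F" "a \<in> F \<Longrightarrow> b \<in> F \<Longrightarrow> a + b \<in> F" "a \<in> F \<Longrightarrow> b \<in> F \<Longrightarrow> a * b \<in> F"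
    "a \<in> F \<Longrightarrow> - a \<in> F" "a \<in> F \<Longrightarrow> inverse a \<in> F"
proof -
  note R = subringE[OF subfieldE(1)[OF assms]]
  show "0 \<in> F" "1 \<in> F" "a \<in> F \<Longrightarrow> b \<in> F \<Longrightarrow> a + b \<in> F" "a \<in> F \<Longrightarrow> b \<in> F \<Longrightarrow> a * b \<in> F"
    "a \<in> F \<Longrightarrow> - a \<in> F"
    using R(2,3) R(5)[of a] R(6)[of a b] R(7)[of a b] by (simp_all add: class_ring_simps)
  show "inverse a \<in> F" if "a \<in> F"
    using ring.subfield_m_inv(1)[OF class_ring.ring_axioms assms, of a] that \<open>0 \<in> F\<close>
    by (cases "a = 0") (auto simp: class_ring_simps)
qed

context
  fixes F :: "'k::{field,finite} set"
  assumes F: "subfield F class_ring"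
begin

lemma subfield_card: "card F \<ge> 2"
  using card_mono[of F "{0, 1}"] subfield_class_ring[OF F] by simp

lemma subfield_shift_image:
  "a \<in> F \<Longrightarrow> (+) a ` F = F"
  "a \<in> F \<Longrightarrow> a \<noteq> 0 \<Longrightarrow> (*) a ` F = F"
  "a \<in> F \<Longrightarrow> a \<noteq> 0 \<Longrightarrow> (*) a ` (F - {0}) = F - {0}"
  using subfield_class_ring[OF F]
  by (intro endo_inj_surj; force intro: inj_onI)+

text \<open>Multiplication by \<open>a\<close> permutes \<open>F - {0}\<close>; comparing the
  product of all nonzero elements before and after leaves the factor
  \<open>a ^ (card F - 1)\<close>.\<close>

lemma subfield_power_card:
  assumes "a \<in> F" "a \<noteq> 0"
  shows "a ^ (card F - 1) = 1"
proof -
  have "(\<Prod>c\<in>F - {0}. c) = (\<Prod>c\<in>F - {0}. a * c)"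
    using subfield_shift_image(3)[OF assms] assms(2)
    by (subst (1) subfield_shift_image(3)[OF assms, symmetric], subst prod.reindex) (auto intro: inj_onI)
  also have "\<dots> = a ^ (card F - 1) * (\<Prod>c\<in>F - {0}. c)"
    using subfield_class_ring(1)[OF F] by (simp add: prod.distrib card_Diff_singleton)
  finally show ?thesis by simp
qed

text \<open>The sum over \<open>F\<close> is unchanged when every \<open>c\<close> is replaced by
  \<open>1 + c\<close>, yet this adds 1 exactly \<open>card F\<close> times.\<close>

lemma of_nat_card_subfield: "of_nat (card F) = (0 :: 'k)"
proof -
  have "(\<Sum>c\<in>F. c) = (\<Sum>c\<in>F. 1 + c)"
    using subfield_shift_image(1)[OF subfield_class_ring(2)[OF F]]
    by (metis (no_types, lifting) sum.reindex inj_on_add o_def sum.cong)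
  then show ?thesis by (simp add: sum.distrib)
qed

text \<open>For \<open>e = 0\<close> every summand is 1, including \<open>0 ^ 0\<close>, and the sum
  is \<open>card F\<close>, which is zero in the field. Otherwise \<open>T ^ e - 1\<close> has at
  most \<open>e\<close> roots, too few to cover \<open>F - {0}\<close>, so some nonzero
  \<open>b\<close> has \<open>b ^ e\<close> different from 1; scaling by \<open>b\<close> permutes
  \<open>F\<close> and multiplies the sum by \<open>b ^ e\<close>.\<close>

lemma sum_power_subfield:
  assumes "e < card F - 1"
  shows "(\<Sum>c\<in>F. c ^ e) = 0"
proof (cases "e = 0")
  case True
  then show ?thesis by (simp add: of_nat_card_subfield)
next
  case False
  let ?p = "Polynomial.monom 1 e - 1 :: 'k poly"
  have deg: "degree ?p \<le> e" "?p \<noteq> 0"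
  proof -
    show "degree ?p \<le> e" by (intro degree_diff_le) (auto simp: degree_monom_le)
    have "coeff ?p e = 1" using False by (simp add: coeff_1)
    then show "?p \<noteq> 0" by (metis coeff_0 zero_neq_one)
  qed
  have "\<not> F - {0} \<subseteq> {x. poly ?p x = 0}"
  proof
    assume "F - {0} \<subseteq> {x. poly ?p x = 0}"
    then have "card (F - {0}) \<le> card {x. poly ?p x = 0}" by (intro card_mono) auto
    also have "\<dots> \<le> e" using card_poly_roots_bound[OF deg(2)] deg(1) by simp
    finally show False using assms subfield_class_ring(1)[OF F] by (simp add: card_Diff_singleton)
  qed
  then obtain b where b: "b \<in> F" "b \<noteq> 0" "b ^ e \<noteq> 1" by (auto simp: poly_monom)
  have "(\<Sum>c\<in>F. c ^ e) = (\<Sum>c\<in>F. (b * c) ^ e)"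
    using b(2) by (subst (1) subfield_shift_image(2)[OF b(1,2), symmetric], subst sum.reindex) (auto intro: inj_onI)
  also have "\<dots> = b ^ e * (\<Sum>c\<in>F. c ^ e)"
    by (simp add: power_mult_distrib sum_distrib_left)
  finally show ?thesis using b by simp
qed

text \<open>Lagrange's theorem for the multiplicative groups: the cosets of \<open>F - {0}\<close>
  partition \<open>G - {0}\<close> into blocks of size \<open>card F - 1\<close>.\<close>

lemma card_subfield_dvd:
  assumes "subfield G class_ring" "F \<subseteq> G"
  shows "card F - 1 dvd card G - 1"
proof -
  let ?C = "(\<lambda>c. (*) c ` (F - {0})) ` (G - {0})"
  have "card F - 1 dvd card (\<Union>?C)"
  proof (rule dvd_partition)
    show "\<forall>c\<in>?C. card F - 1 dvd card c"
      using subfield_class_ring(1)[OF F]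
      by (auto simp: card_image inj_on_def card_Diff_singleton)
    show "\<forall>c1\<in>?C. \<forall>c2\<in>?C. c1 \<noteq> c2 \<longrightarrow> c1 \<inter> c2 = {}"
    proof (intro ballI impI, rule ccontr)
      fix c1 c2 assume c: "c1 \<in> ?C" "c2 \<in> ?C" and ne: "c1 \<noteq> c2" and "c1 \<inter> c2 \<noteq> {}"
      then obtain c d a b where cd: "c \<noteq> 0" "d \<noteq> 0" and ab: "a \<in> F" "a \<noteq> 0" "b \<in> F" "b \<noteq> 0"
        and eq: "c * a = d * b" and c1: "c1 = (*) c ` (F - {0})" and c2: "c2 = (*) d ` (F - {0})"
        by auto
      have *: "b * inverse a \<in> F" "b * inverse a \<noteq> 0"
        using ab subfield_class_ring[OF F] by auto
      have "c = d * (b * inverse a)" using eq ab by (simp add: field_simps)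
      then have "c1 = (*) d ` (*) (b * inverse a) ` (F - {0})"
        by (simp add: c1 image_image mult_ac)
      then show False using ne c2 subfield_shift_image(3)[OF *] by simp
    qed
  qed simp
  moreover have "\<Union>?C = G - {0}"
  proof
    show "\<Union>?C \<subseteq> G - {0}"
      using subfield_class_ring(4)[OF assms(1)] assms(2) by auto
    show "G - {0} \<subseteq> \<Union>?C"
    proof
      fix c assume c: "c \<in> G - {0}"
      have "c \<in> (*) c ` (F - {0})"
        using subfield_class_ring(2)[OF F] by (intro image_eqI[of _ _ 1]) auto
      then show "c \<in> \<Union>?C" using c by blast
    qed
  qed
  ultimately show ?thesis
    using subfield_class_ring(1)[OF assms(1)] by (simp add: card_Diff_singleton)
qed

end

section \<open>Functions represented by forms of a given degree\<close>

text \<open>Treating forms as functions allows sums, products, powers and linear substitutions to be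
  shown to have a given degree without writing down the polynomial.\<close>

definition hom_fun :: "nat \<Rightarrow> nat \<Rightarrow> ((nat \<Rightarrow> 'k::field) \<Rightarrow> 'k) set" where
  "hom_fun n d = (\<lambda>f x. peval x f) ` hom_part n d"

lemma hom_funI: "f \<in> hom_part n d \<Longrightarrow> (\<And>x. \<phi> x = peval x f) \<Longrightarrow> \<phi> \<in> hom_fun n d"
  by (auto simp: hom_fun_def)

lemma hom_funE:
  assumes "\<phi> \<in> hom_fun n d"
  obtains f where "f \<in> hom_part n d" "\<phi> = (\<lambda>x. peval x f)"
  using assms by (auto simp: hom_fun_def)

lemma hom_fun_sum:
  assumes "\<And>i. i \<in> A \<Longrightarrow> \<phi> i \<in> hom_fun n d"
  shows "(\<lambda>x. \<Sum>i\<in>A. \<phi> i x) \<in> hom_fun n d"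
proof -
  have "\<forall>i\<in>A. \<exists>f\<in>hom_part n d. \<phi> i = (\<lambda>x. peval x f)" using assms by (auto simp: hom_fun_def)
  then obtain f where "\<forall>i\<in>A. f i \<in> hom_part n d \<and> \<phi> i = (\<lambda>x. peval x (f i))" by metis
  then show ?thesis
    by (intro hom_funI[of "\<Sum>i\<in>A. f i"] hom_part_sum) (auto simp: peval_sum intro: sum.cong)
qed

lemma hom_fun_add: "\<phi> \<in> hom_fun n d \<Longrightarrow> \<psi> \<in> hom_fun n d \<Longrightarrow> (\<lambda>x. \<phi> x + \<psi> x) \<in> hom_fun n d"
  by (elim hom_funE, rule hom_funI, erule (1) hom_part_add) (simp add: peval_add)

lemma hom_fun_mult: "\<phi> \<in> hom_fun n d \<Longrightarrow> \<psi> \<in> hom_fun n e \<Longrightarrow> (\<lambda>x. \<phi> x * \<psi> x) \<in> hom_fun n (d + e)"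
  by (elim hom_funE, rule hom_funI, erule (1) hom_part_mult) (simp add: peval_mult)

lemma hom_fun_const: "(\<lambda>x. c) \<in> hom_fun n 0"
  by (rule hom_funI[OF hom_part_single[of 0]]) (simp_all add: peval_single)

lemma hom_fun_smult: "\<phi> \<in> hom_fun n d \<Longrightarrow> (\<lambda>x. c * \<phi> x) \<in> hom_fun n d"
  using hom_fun_mult[OF hom_fun_const] by fastforce

lemma hom_fun_coord: "i \<le> n \<Longrightarrow> (\<lambda>x. x i) \<in> hom_fun n 1"
  by (rule hom_funI[OF hom_part_single[of "Poly_Mapping.single i 1" n 1 1]])
    (simp_all add: mono_deg_def mono_eval_def peval_single)

lemma hom_fun_power: "\<phi> \<in> hom_fun n d \<Longrightarrow> (\<lambda>x. \<phi> x ^ k) \<in> hom_fun n (k * d)"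
  by (induction k) (auto simp: hom_fun_const hom_fun_mult)

lemma hom_fun_prod:
  "(\<And>i. i \<in> A \<Longrightarrow> \<phi> i \<in> hom_fun n (e i)) \<Longrightarrow> (\<lambda>x. \<Prod>i\<in>A. \<phi> i x) \<in> hom_fun n (\<Sum>i\<in>A. e i)"
  by (induction A rule: infinite_finite_induct) (auto simp: hom_fun_const hom_fun_mult)

text \<open>Replacing every variable by a linear form turns a monomial of degree \<open>d\<close>
  into a product of \<open>d\<close> linear forms. This later moves indicators from one point to
  another.\<close>

lemma hom_fun_subst:
  assumes "\<phi> \<in> hom_fun n d" "\<And>i. i \<le> n \<Longrightarrow> (\<lambda>x. \<sigma> x i) \<in> hom_fun n 1"
  shows "(\<lambda>x. \<phi> (\<sigma> x)) \<in> hom_fun n d"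
proof -
  from assms(1) obtain f where f: "f \<in> hom_part n d" "\<phi> = (\<lambda>x. peval x f)"
    by (rule hom_funE)
  have "(\<lambda>x. mono_eval (\<sigma> x) m) \<in> hom_fun n d" if "m \<in> Poly_Mapping.keys f" for m
  proof -
    have "(\<lambda>x. \<Prod>i\<in>Poly_Mapping.keys m. \<sigma> x i ^ Poly_Mapping.lookup m i)
        \<in> hom_fun n (\<Sum>i\<in>Poly_Mapping.keys m. Poly_Mapping.lookup m i * 1)"
      using f that by (intro hom_fun_prod hom_fun_power assms(2)) (auto simp: hom_part_def mpoly_carrier)
    then show ?thesis using f that by (auto simp: mono_eval_def hom_part_def mono_deg_def)
  qed
  then show ?thesis
    unfolding f(2) peval_eq_sum by (intro hom_fun_sum hom_fun_smult)
qed

lemma hom_fun_scale: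
  assumes "\<phi> \<in> hom_fun n d"
  shows "\<phi> (\<lambda>i. c * x i) = c ^ d * \<phi> x"
proof -
  from assms obtain f where f: "f \<in> hom_part n d" "\<phi> = (\<lambda>x. peval x f)"
    by (rule hom_funE)
  have "mono_eval (\<lambda>i. c * x i) m = c ^ mono_deg m * mono_eval x m" for m
    by (simp add: mono_eval_def mono_deg_def power_mult_distrib prod.distrib power_sum)
  then show ?thesis
    using f by (auto simp: peval_eq_sum sum_distrib_left hom_part_def mult_ac intro: sum.cong)
qed

section \<open>Indicator functions of points\<close>

locale subfield_tower =
  fixes n :: nat and F :: "nat \<Rightarrow> 'k::{field,finite} set"
  assumes subfield: "\<And>i. i \<le> n \<Longrightarrow> subfield (F i) class_ring"
    and tower_Suc: "\<And>i. i < n \<Longrightarrow> F i \<subseteq> F (Suc i)"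
begin

definition w :: "nat \<Rightarrow> nat" where "w i = card (F i) - 1"

definition W :: nat where "W = (\<Sum>i\<le>n. w i)"

definition grid :: "(nat \<Rightarrow> 'k) set" where
  "grid = {a. (\<forall>i\<le>n. a i \<in> F i) \<and> (\<forall>i>n. a i = 0)}"

definition unit_vec :: "nat \<Rightarrow> nat \<Rightarrow> 'k" where
  "unit_vec k = (\<lambda>i. if i = k then 1 else 0)"

text \<open>Zeros are demanded at all grid vectors off the line through \<open>x\<close>, not only
  at representatives of the other points, so that sums over the product set \<open>grid\<close> can
  be evaluated. The zero vector lies on that line (\<open>c = 0\<close>) and is exempt.\<close>

definition indicator_deg :: "nat \<Rightarrow> (nat \<Rightarrow> 'k) \<Rightarrow> bool" where
  "indicator_deg d x \<longleftrightarrow> (\<exists>\<phi>\<in>hom_fun n d. \<phi> x \<noteq> 0 \<and>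
    (\<forall>a\<in>grid. (\<nexists>c. a = (\<lambda>i. c * x i)) \<longrightarrow> \<phi> a = 0))"

section \<open>Divisibilities in the tower and sums over the grid\<close>

lemma tower: "i \<le> j \<Longrightarrow> j \<le> n \<Longrightarrow> F i \<subseteq> F j"
proof (induction j)
  case (Suc j)
  then show ?case using tower_Suc[of j] by (cases "i = Suc j") auto
qed simp

lemmas F_closed = subfield_class_ring[OF subfield]

lemma w_pos: "i \<le> n \<Longrightarrow> w i \<ge> 1"
  using subfield_card[OF subfield] by (fastforce simp: w_def)

lemma w_dvd: "i \<le> j \<Longrightarrow> j \<le> n \<Longrightarrow> w i dvd w j"
  unfolding w_def by (intro card_subfield_dvd subfield tower) auto

lemma power_eq_1: "i \<le> n \<Longrightarrow> a \<in> F i \<Longrightarrow> a \<noteq> 0 \<Longrightarrow> w i dvd e \<Longrightarrow> a ^ e = 1"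
  using subfield_power_card[OF subfield] by (auto simp: w_def power_mult)

lemma W_remove: "k \<le> n \<Longrightarrow> W = w k + (\<Sum>i\<in>{..n} - {k}. w i)"
  unfolding W_def by (simp add: sum.remove)

lemma sum_grid_prod:
  fixes p :: "nat \<Rightarrow> 'k \<Rightarrow> 'k"
  shows "(\<Sum>a\<in>grid. \<Prod>i\<le>n. p i (a i)) = (\<Prod>i\<le>n. \<Sum>c\<in>F i. p i c)"
proof -
  have "(\<Sum>a\<in>grid. \<Prod>i\<le>n. p i (a i)) = (\<Sum>g\<in>PiE {..n} F. \<Prod>i\<le>n. p i (g i))"
    \<comment> \<open>Grid vectors are 0 beyond index \<open>n\<close>, whereas members of
      \<open>PiE\<close> are \<open>undefined\<close> there; the two witnesses convert between these
      defaults.\<close>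
    by (rule sum.reindex_bij_witness[where j = "\<lambda>a. restrict a {..n}"
          and i = "\<lambda>g i. if i \<le> n then g i else 0"])
      (auto simp: grid_def PiE_def extensional_def intro!: ext)
  then show ?thesis by (simp add: prod_sum_PiE)
qed

lemma of_nat_w: "k \<le> n \<Longrightarrow> of_nat (w k) = (- 1 :: 'k)"
  using of_nat_card_subfield[OF subfield, of k] subfield_card[OF subfield, of k]
  by (simp add: w_def of_nat_diff)

text \<open>Pairing with \<open>a\<^sub>k ^ p\<close> over the grid kills every monomial that is not divisible by
  \<open>t\<^sub>k ^ r * (\<Prod>i \<noteq> k. t\<^sub>i ^ w i)\<close>, but not the indicator function.\<close>

lemma indicator_deg_lower:
  assumes k: "k \<le> n" and d: "d \<ge> 1" and ind: "indicator_deg d (unit_vec k)"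
  shows "d \<ge> 1 + w k * ((W - 1) div w k)"
proof -
  from ind obtain f where f: "f \<in> hom_part n d" and fk: "peval (unit_vec k) f \<noteq> 0"
    and f0: "\<And>a. a \<in> grid \<Longrightarrow> (\<nexists>c. a = (\<lambda>i. c * unit_vec k i)) \<Longrightarrow> peval a f = 0"
    unfolding indicator_deg_def by (auto elim!: hom_funE)
  \<comment> \<open>\<open>r\<close> is the residue of \<open>d\<close> modulo \<open>w k\<close>
    chosen in \<open>1..w k\<close> rather than from 0, and \<open>p\<close> is the complement that
    makes \<open>d + p\<close> a multiple of \<open>w k\<close>.\<close>
  define r where "r = 1 + (d - 1) mod w k"
  define p where "p = w k - r"
  have wk: "w k \<ge> 1" using w_pos[OF k] .
  have r: "1 \<le> r" "r \<le> w k" using wk by (auto simp: r_def Suc_le_eq)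
  have dp: "w k dvd d + p"
  proof -
    have "d + p = (d - 1) - (d - 1) mod w k + w k"
      using d r unfolding p_def r_def using mod_less_eq_dividend[of "d - 1" "w k"] by linarith
    then show ?thesis by (simp add: minus_mod_eq_mult_div)
  qed
  have exps: "(\<Sum>a\<in>grid. mono_eval a m * a k ^ p) =
    (\<Prod>i\<le>n. \<Sum>c\<in>F i. c ^ (Poly_Mapping.lookup m i + (if i = k then p else 0)))"
    if "m \<in> Poly_Mapping.keys f" for m
  proof -
    have km: "Poly_Mapping.keys m \<subseteq> {..n}" using f that by (auto simp: hom_part_def mpoly_carrier)
    have "mono_eval a m * a k ^ p =
      (\<Prod>i\<le>n. a i ^ (Poly_Mapping.lookup m i + (if i = k then p else 0)))" for a :: "nat \<Rightarrow> 'k"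
    proof -
      have "a k ^ p = (\<Prod>i\<le>n. a i ^ (if i = k then p else 0))"
        using k by (simp add: if_distrib[of "\<lambda>e. a _ ^ e"] prod.delta cong: if_cong)
      then show ?thesis
        by (simp add: mono_eval_superset[OF _ km] power_add prod.distrib)
    qed
    then show ?thesis using sum_grid_prod[of "\<lambda>i c. c ^ _ i"] by simp
  qed
  \<comment> \<open>Only the multiples of \<open>unit_vec k\<close> by some \<open>c\<close> in
    \<open>F k\<close> survive. By homogeneity each contributes \<open>c ^ (d + p)\<close> times the
    value at \<open>unit_vec k\<close>, and this power is 1 for \<open>c\<close> nonzero; the
    \<open>w k\<close> equal terms add up to minus that value.\<close>
  have "(\<Sum>a\<in>grid. peval a f * a k ^ p) = (\<Sum>c\<in>F k. peval (\<lambda>i. c * unit_vec k i) f * c ^ p)"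
  proof -
    let ?l = "\<lambda>c i. c * unit_vec k i"
    have inj: "inj_on ?l (F k)" by (auto simp: inj_on_def fun_eq_iff unit_vec_def)
    have sub: "?l ` F k \<subseteq> grid" using k F_closed(1) by (auto simp: grid_def unit_vec_def)
    have "(\<Sum>a\<in>grid. peval a f * a k ^ p) = (\<Sum>a\<in>?l ` F k. peval a f * a k ^ p)"
    proof (rule sum.mono_neutral_right)
      show "finite grid"
        by (rule finite_subset[OF _ finite_set_of_finite_funs[of "{..n}" UNIV 0]]) (auto simp: grid_def)
      show "\<forall>a\<in>grid - ?l ` F k. peval a f * a k ^ p = 0"
      proof
        fix a assume a: "a \<in> grid - ?l ` F k"
        have "\<nexists>c. a = ?l c"
        proof
          assume "\<exists>c. a = ?l c"
          then obtain c where c: "a = ?l c" ..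
          have "a k \<in> F k" using a k by (auto simp: grid_def)
          then have "c \<in> F k" by (simp add: c unit_vec_def)
          then show False using a c by auto
        qed
        then show "peval a f * a k ^ p = 0" using f0 a by simp
      qed
    qed (rule sub)
    moreover have "unit_vec k k = 1" by (simp add: unit_vec_def)
    ultimately show ?thesis by (simp add: sum.reindex[OF inj])
  qed
  also have "\<dots> = (\<Sum>c\<in>F k. c ^ (d + p) * peval (unit_vec k) f)"
    by (simp add: hom_fun_scale[OF hom_funI[OF f refl]] power_add mult_ac)
  also have "\<dots> = (\<Sum>c\<in>F k - {0}. peval (unit_vec k) f)"
    using power_eq_1[OF k] dp d F_closed(1)[OF k]
    by (intro sum.mono_neutral_cong_right) auto
  also have "\<dots> = - peval (unit_vec k) f"
    using F_closed(1)[OF k] of_nat_w[OF k] by (simp add: card_Diff_singleton w_def)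
  finally have "(\<Sum>a\<in>grid. peval a f * a k ^ p) \<noteq> 0" using fk by simp
  moreover have "(\<Sum>a\<in>grid. peval a f * a k ^ p) =
    (\<Sum>m\<in>Poly_Mapping.keys f. Poly_Mapping.lookup f m * (\<Sum>a\<in>grid. mono_eval a m * a k ^ p))"
    unfolding peval_eq_sum sum_distrib_right sum_distrib_left by (subst sum.swap) (simp add: mult_ac)
  ultimately obtain m where m: "m \<in> Poly_Mapping.keys f" and "(\<Sum>a\<in>grid. mono_eval a m * a k ^ p) \<noteq> 0"
    by (metis (no_types, lifting) mult_zero_right sum.neutral)
  \<comment> \<open>The pairing with \<open>m\<close> is a product of power sums, one per
    coordinate, so none of them vanishes and every exponent must reach \<open>w i\<close>.\<close>
  then have "(\<Sum>c\<in>F i. c ^ (Poly_Mapping.lookup m i + (if i = k then p else 0))) \<noteq> 0"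
    if "i \<le> n" for i using that exps[OF m] by auto
  then have ge: "Poly_Mapping.lookup m i + (if i = k then p else 0) \<ge> w i" if "i \<le> n" for i
    using that sum_power_subfield[OF subfield] by (metis not_le w_def)
  have "d = (\<Sum>i\<le>n. Poly_Mapping.lookup m i)"
    using f m mono_deg_superset[of "{..n}" m] by (auto simp: hom_part_def mpoly_carrier)
  also have "\<dots> = Poly_Mapping.lookup m k + (\<Sum>i\<in>{..n} - {k}. Poly_Mapping.lookup m i)"
    using k by (simp add: sum.remove)
  also have "\<dots> \<ge> r + (\<Sum>i\<in>{..n} - {k}. w i)"
  proof (intro add_mono sum_mono)
    show "r \<le> Poly_Mapping.lookup m k" using ge[OF k] r by (simp add: p_def)
    show "w i \<le> Poly_Mapping.lookup m i" if "i \<in> {..n} - {k}" for i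
      using ge[of i] that by auto
  qed
  finally have "d \<ge> r + (W - w k)" using W_remove[OF k] by simp
  \<comment> \<open>Since \<open>d - r\<close> equals \<open>w k * ((d - 1) div w k)\<close>, the
    degree bound says that the next multiple of \<open>w k\<close> is at least \<open>W\<close>. The
    largest multiple of \<open>w k\<close> not exceeding \<open>W - 1\<close> is therefore at most
    \<open>d - 1\<close>.\<close>
  then have ge_W: "w k * ((d - 1) div w k) + w k \<ge> W"
    using d unfolding r_def minus_mod_eq_mult_div[symmetric] by linarith
  have "W \<ge> 1" using W_remove[OF k] wk by simp
  then have "w k * ((W - 1) div w k) < w k * ((d - 1) div w k + 1)"
  proof -
    have "w k * ((W - 1) div w k) \<le> W - 1" by (rule times_div_less_eq_dividend)
    then have "w k * ((W - 1) div w k) < w k * ((d - 1) div w k) + w k"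
      using ge_W \<open>W \<ge> 1\<close> by linarith
    then show ?thesis by simp
  qed
  then have "(W - 1) div w k \<le> (d - 1) div w k" unfolding mult_less_cancel1 by simp
  then have "w k * ((W - 1) div w k) \<le> w k * ((d - 1) div w k)" by simp
  also have "\<dots> \<le> d - 1" by simp
  finally show ?thesis using d by simp
qed

text \<open>Each monomial \<open>t\<^sub>k * (\<Prod>i\<in>T. t\<^sub>i ^ w i)\<close> of the reduced indicator function is
  brought to degree \<open>d\<close> by raising its variable of least index \<open>j\<close>: on the grid the
  exponent of \<open>t\<^sub>j\<close> matters only modulo \<open>w j\<close>, and \<open>w j\<close> divides all later
  \<open>w i\<close>.\<close>

lemma indicator_deg_unit_vec:
  assumes k: "k \<le> n"
  shows "indicator_deg (1 + w k * ((W - 1) div w k)) (unit_vec k)"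
proof -
  define d where "d = 1 + w k * ((W - 1) div w k)"
  define I where "I = {..n} - {k}"
  have wk: "w k \<ge> 1" using w_pos[OF k] .
  \<comment> \<open>The largest multiple of \<open>w k\<close> not exceeding \<open>W - 1\<close> is
    at least \<open>W - w k\<close>, so \<open>d\<close> leaves room even for the monomial with
    \<open>T = I\<close>.\<close>
  have d_ge: "d \<ge> 1 + (\<Sum>i\<in>I. w i)"
  proof -
    have "W - 1 < w k * ((W - 1) div w k) + w k"
      using wk by (metis add.commute add_le_cancel_left dividend_less_times_div mult.commute not_le
          Suc_le_eq One_nat_def)
    then show ?thesis using W_remove[OF k] unfolding d_def I_def by linarith
  qed
  define j where "j T = Min (insert k T)" for T
  define e where "e T = d - (1 + (\<Sum>i\<in>T. w i))" for T
  define \<phi> where "\<phi> a = (\<Sum>T\<in>Pow I. (- 1) ^ card T * (a k * (\<Prod>i\<in>T. a i ^ w i) * a (j T) ^ e T))"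
    for a :: "nat \<Rightarrow> 'k"
  have fin: "finite T" if "T \<subseteq> I" for T using that finite_subset by (auto simp: I_def)
  have j_in: "j T \<in> insert k T" "j T \<le> n" if "T \<subseteq> I" for T
  proof -
    show "j T \<in> insert k T" unfolding j_def using fin[OF that] by (intro Min_in) auto
    then show "j T \<le> n" using k that by (auto simp: I_def)
  qed
  have e: "1 + (\<Sum>i\<in>T. w i) + e T = d" if "T \<subseteq> I" for T
  proof -
    have "(\<Sum>i\<in>T. w i) \<le> (\<Sum>i\<in>I. w i)" using that by (intro sum_mono2) (auto simp: I_def)
    then show ?thesis using d_ge by (simp add: e_def)
  qed
  \<comment> \<open>The special form of \<open>d\<close> enters here: \<open>d - 1\<close> is a
    multiple of \<open>w k\<close>, hence of \<open>w (j T)\<close> because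
    \<open>j T \<le> k\<close>. The degrees \<open>w i\<close> with \<open>i\<close> in
    \<open>T\<close> are multiples of \<open>w (j T)\<close> as well.\<close>
  have dvd: "w (j T) dvd e T" if "T \<subseteq> I" for T
  proof -
    have le: "j T \<le> i" if "i \<in> insert k T" for i
      using that fin[OF \<open>T \<subseteq> I\<close>] unfolding j_def by (intro Min_le) auto
    have "w (j T) dvd (\<Sum>i\<in>T. w i)"
      using le that by (intro dvd_sum w_dvd) (auto simp: I_def)
    moreover have "w (j T) dvd d - 1"
      using w_dvd[OF le[of k] k] by (simp add: d_def)
    moreover have "e T = (d - 1) - (\<Sum>i\<in>T. w i)" by (simp add: e_def)
    ultimately show ?thesis by (metis dvd_diff_nat)
  qed
  have "\<phi> \<in> hom_fun n d"
    unfolding \<phi>_def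
  proof (intro hom_fun_sum hom_fun_smult)
    fix T assume T: "T \<in> Pow I"
    have "(\<lambda>a :: nat \<Rightarrow> 'k. a k * (\<Prod>i\<in>T. a i ^ w i) * a (j T) ^ e T)
        \<in> hom_fun n (1 + (\<Sum>i\<in>T. w i * 1) + e T * 1)"
      using T j_in k by (intro hom_fun_mult hom_fun_prod hom_fun_power hom_fun_coord) (auto simp: I_def)
    then show "(\<lambda>a :: nat \<Rightarrow> 'k. a k * (\<Prod>i\<in>T. a i ^ w i) * a (j T) ^ e T) \<in> hom_fun n d"
      using e T by simp
  qed
  moreover have eq: "\<phi> a = a k * (\<Prod>i\<in>I. 1 - a i ^ w i)" if "a \<in> grid" for a
  proof -
    have "a k * (\<Prod>i\<in>T. a i ^ w i) * a (j T) ^ e T = a k * (\<Prod>i\<in>T. a i ^ w i)" if T: "T \<subseteq> I" for T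
    proof (cases "a (j T) = 0")
      \<comment> \<open>The variable of index \<open>j T\<close> already occurs in the unpadded
        monomial with positive exponent, so both sides are zero whatever \<open>e T\<close>
        is.\<close>
      case True
      have "w i \<noteq> 0" if "i \<in> T" for i using w_pos[of i] that T by (fastforce simp: I_def)
      then have "a k * (\<Prod>i\<in>T. a i ^ w i) = 0"
        using True j_in(1)[OF T] fin[OF T] by auto
      then show ?thesis by simp
    next
      case False
      have "a (j T) \<in> F (j T)" using \<open>a \<in> grid\<close> j_in(2)[OF T] by (simp add: grid_def)
      then show ?thesis using power_eq_1[OF j_in(2)[OF T] _ False dvd[OF T]] by simp
    qed
    then have "\<phi> a = (\<Sum>T\<in>Pow I. (- 1) ^ card T * (a k * (\<Prod>i\<in>T. a i ^ w i)))"
      unfolding \<phi>_def by (intro sum.cong) auto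
    also have "\<dots> = a k * (\<Prod>i\<in>I. - (a i ^ w i) + 1)"
      by (subst prod_add) (auto simp: I_def sum_distrib_left prod_uminus mult_ac)
    finally show ?thesis by simp
  qed
  moreover have "\<phi> (unit_vec k) = 1"
  proof -
    have "unit_vec k \<in> grid" using k F_closed(1,2) by (auto simp: grid_def unit_vec_def)
    moreover have "(\<Prod>i\<in>I. 1 - unit_vec k i ^ w i) = 1"
      using w_pos by (intro prod.neutral) (force simp: I_def unit_vec_def)
    ultimately show ?thesis using eq by (simp add: unit_vec_def)
  qed
  moreover have "\<phi> a = 0" if a: "a \<in> grid" "\<nexists>c. a = (\<lambda>i. c * unit_vec k i)" for a
  proof -
    have "\<exists>i\<in>I. a i \<noteq> 0"
    proof (rule ccontr)
      assume "\<not> ?thesis"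
      then have "a i = a k * unit_vec k i" for i
        using a(1) by (cases "i \<le> n") (auto simp: grid_def unit_vec_def I_def)
      then have "a = (\<lambda>i. a k * unit_vec k i)" by blast
      then show False using a(2) by blast
    qed
    then obtain i where i: "i \<in> I" "a i \<noteq> 0" by blast
    then have "1 - a i ^ w i = 0" using a(1) power_eq_1[of i "a i" "w i"] by (auto simp: grid_def I_def)
    then have "(\<Prod>i\<in>I. 1 - a i ^ w i) = 0" using i by (intro prod_zero) (auto simp: I_def)
    then show ?thesis using eq a by simp
  qed
  ultimately show ?thesis unfolding indicator_deg_def d_def by (intro bexI[of _ \<phi>]) auto
qed

section \<open>Transport of indicators between points and between degrees\<close>

lemma indicator_deg_subst:
  assumes "indicator_deg d x" "\<sigma> y = x" "\<And>a. a \<in> grid \<Longrightarrow> \<sigma> a \<in> grid"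
    "\<And>i. i \<le> n \<Longrightarrow> (\<lambda>a. \<sigma> a i) \<in> hom_fun n 1"
    "\<And>a c. a \<in> grid \<Longrightarrow> \<sigma> a = (\<lambda>i. c * x i) \<Longrightarrow> \<exists>c. a = (\<lambda>i. c * y i)"
  shows "indicator_deg d y"
proof -
  from assms(1) obtain \<phi> where \<phi>: "\<phi> \<in> hom_fun n d" "\<phi> x \<noteq> 0"
    "\<And>a. a \<in> grid \<Longrightarrow> (\<nexists>c. a = (\<lambda>i. c * x i)) \<Longrightarrow> \<phi> a = 0"
    unfolding indicator_deg_def by blast
  have "(\<lambda>a. \<phi> (\<sigma> a)) \<in> hom_fun n d" by (rule hom_fun_subst[OF \<phi>(1) assms(4)])
  then show ?thesis
    unfolding indicator_deg_def using \<phi> assms(2,3,5) by (intro bexI[of _ "\<lambda>a. \<phi> (\<sigma> a)"]) metis+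
qed

text \<open>Standard representatives are sorted by the position of their leading 1, because the
  least indicator degree will depend only on that position.\<close>

definition std_vecs :: "nat \<Rightarrow> (nat \<Rightarrow> 'k) set" where
  "std_vecs k = {x \<in> grid. x k = 1 \<and> (\<forall>i<k. x i = 0)}"

lemma unit_vec_std: "k \<le> n \<Longrightarrow> unit_vec k \<in> std_vecs k"
  using F_closed(1,2) by (auto simp: std_vecs_def grid_def unit_vec_def)

lemma indicator_deg_translate:
  assumes k: "k \<le> n" and x: "x \<in> std_vecs k" and y: "y \<in> std_vecs k" and ind: "indicator_deg d x"
  shows "indicator_deg d y"
proof -
  \<comment> \<open>\<open>x\<close> and \<open>y\<close> agree up to index \<open>k\<close>, so
    this shear fixes all coordinates up to \<open>k\<close> and is undone by subtracting the same
    multiple of \<open>\<sigma> a k\<close>. It preserves the grid since \<open>F k\<close> lies in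
    every later \<open>F i\<close>.\<close>
  define \<sigma> where "\<sigma> a = (\<lambda>i. a i + (x i - y i) * a k)" for a :: "nat \<Rightarrow> 'k"
  have z: "x k - y k = 0" using x y by (simp add: std_vecs_def)
  have inv: "a i = \<sigma> a i - (x i - y i) * \<sigma> a k" for a i
    using z by (simp add: \<sigma>_def)
  show ?thesis
  proof (rule indicator_deg_subst[OF ind, of \<sigma> y])
    show "\<sigma> y = x" using y by (auto simp: \<sigma>_def std_vecs_def)
    show "\<sigma> a \<in> grid" if a: "a \<in> grid" for a
    proof -
      have "\<sigma> a i \<in> F i" if i: "i \<le> n" for i
      proof (cases "i < k")
        case True
        then show ?thesis using a x y i by (auto simp: \<sigma>_def std_vecs_def grid_def)
      next
        case False
        then have "a k \<in> F i" using tower[of k i] a k i by (auto simp: grid_def)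
        moreover have "x i \<in> F i" "y i \<in> F i" "a i \<in> F i"
          using a x y i by (auto simp: std_vecs_def grid_def)
        ultimately show ?thesis
          unfolding \<sigma>_def diff_conv_add_uminus by (intro F_closed(3-5)[OF i])
      qed
      moreover have "\<sigma> a i = 0" if "i > n" for i
        using that a x y by (auto simp: \<sigma>_def std_vecs_def grid_def)
      ultimately show ?thesis by (simp add: grid_def)
    qed
    show "(\<lambda>a. \<sigma> a i) \<in> hom_fun n 1" if "i \<le> n" for i
      unfolding \<sigma>_def by (intro hom_fun_add hom_fun_smult hom_fun_coord that k)
    show "\<exists>c. a = (\<lambda>i. c * y i)" if "\<sigma> a = (\<lambda>i. c * x i)" for a c
    proof (intro exI[of _ c] ext)
      fix i
      have "a i = c * x i - (x i - y i) * (c * x k)" by (subst inv) (simp add: that)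
      then show "a i = c * y i" using x by (simp add: std_vecs_def algebra_simps)
    qed
  qed
qed

text \<open>Multiplying by a coordinate that is nonzero at \<open>x\<close> keeps all zeros and
  loses no value at \<open>x\<close>.\<close>

lemma indicator_deg_Suc:
  assumes "k \<le> n" "x k \<noteq> 0" "indicator_deg d x"
  shows "indicator_deg (Suc d) x"
proof -
  from assms(3) obtain \<phi> where \<phi>: "\<phi> \<in> hom_fun n d" "\<phi> x \<noteq> 0"
    "\<And>a. a \<in> grid \<Longrightarrow> (\<nexists>c. a = (\<lambda>i. c * x i)) \<Longrightarrow> \<phi> a = 0"
    unfolding indicator_deg_def by blast
  have "(\<lambda>a. \<phi> a * a k) \<in> hom_fun n (d + 1)"
    by (intro hom_fun_mult hom_fun_coord \<phi>(1) assms(1))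
  then show ?thesis
    unfolding indicator_deg_def using \<phi> assms(2) by (intro bexI[of _ "\<lambda>a. \<phi> a * a k"]) auto
qed

lemma indicator_deg_pos:
  assumes "n \<ge> 1" "k \<le> n" "indicator_deg d (unit_vec k)"
  shows "d \<ge> 1"
proof (rule ccontr)
  assume "\<not> d \<ge> 1"
  then have "indicator_deg 0 (unit_vec k)" using assms(3) by (cases d) auto
  then obtain \<phi> where \<phi>: "\<phi> \<in> hom_fun n 0" "\<phi> (unit_vec k) \<noteq> 0"
    "\<And>a. a \<in> grid \<Longrightarrow> (\<nexists>c. a = (\<lambda>i. c * unit_vec k i)) \<Longrightarrow> \<phi> a = 0"
    unfolding indicator_deg_def by blast
  define l where "l = (if k = 0 then 1 else 0 :: nat)"
  have l: "l \<le> n" "l \<noteq> k" using assms by (auto simp: l_def)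
  \<comment> \<open>In degree 0 the scaling factor for the scalar 0 is \<open>0 ^ 0 = 1\<close>, so
    a form takes its value at the zero vector everywhere. It cannot vanish at a second unit vector,
    which exists because \<open>n \<ge> 1\<close>.\<close>
  have const: "\<phi> a = \<phi> (\<lambda>i. 0)" for a using hom_fun_scale[OF \<phi>(1), of 0 a] by simp
  have "\<nexists>c. unit_vec l = (\<lambda>i. c * unit_vec k i)"
    using l by (auto simp: fun_eq_iff unit_vec_def intro!: exI[of _ l])
  then have "\<phi> (unit_vec l) = 0" using \<phi>(3) unit_vec_std[OF l(1)] by (auto simp: std_vecs_def)
  then show False using const \<phi>(2) by metis
qed

section \<open>The least indicator degrees: comparison and closed forms\<close>

definition v_deg :: "nat \<Rightarrow> nat" where "v_deg k = 1 + w k * ((W - 1) div w k)"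

lemma indicator_deg_v_deg:
  assumes "k \<le> n" "x \<in> std_vecs k"
  shows "indicator_deg (v_deg k) x"
  using indicator_deg_translate[OF assms(1) unit_vec_std[OF assms(1)] assms(2)]
    indicator_deg_unit_vec[OF assms(1)] by (simp add: v_deg_def)

lemma v_deg_le:
  assumes "n \<ge> 1" "k \<le> n" "x \<in> std_vecs k" "indicator_deg d x"
  shows "v_deg k \<le> d"
  using indicator_deg_translate[OF assms(2,3) unit_vec_std[OF assms(2)] assms(4)]
    indicator_deg_lower[OF assms(2)] indicator_deg_pos[OF assms(1,2)] by (auto simp: v_deg_def)

text \<open>Every multiple of \<open>w j\<close> is a multiple of \<open>w i\<close>, so the largest
  one not exceeding \<open>W - 1\<close> can only be smaller for \<open>j\<close>.\<close>

lemma v_deg_antimono: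
  assumes "i \<le> j" "j \<le> n"
  shows "v_deg j \<le> v_deg i"
proof -
  obtain q where q: "w j = w i * q" using w_dvd[OF assms] by auto
  have "w j * ((W - 1) div w j) = w i * (q * ((W - 1) div w j))" by (subst q) (simp add: mult.assoc)
  also have "\<dots> \<le> w i * ((W - 1) div w i)"
  proof (rule mult_le_mono2)
    show "q * ((W - 1) div w j) \<le> (W - 1) div w i"
    proof -
      have "w i * (q * ((W - 1) div w j)) \<le> W - 1" by (simp flip: q mult.assoc)
      then show ?thesis using w_pos[of i] assms by (simp add: less_eq_div_iff_mult_less_eq mult.commute)
    qed
  qed
  finally show ?thesis by (simp add: v_deg_def)
qed

text \<open>\<open>W - 1\<close> is \<open>?S + (w 0 - 1)\<close> with \<open>?S\<close> a multiple
  of \<open>w 0\<close>, so rounding down to a multiple of \<open>w 0\<close> gives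
  \<open>?S\<close>.\<close>

lemma v_deg_0: "v_deg 0 = 1 + (\<Sum>i=1..n. w i)"
proof -
  let ?S = "\<Sum>i=1..n. w i"
  have W: "W = w 0 + ?S" by (simp add: W_def atMost_atLeast0 sum.atLeast_Suc_atMost)
  have "w 0 dvd ?S" by (intro dvd_sum w_dvd) auto
  then obtain q where q: "?S = w 0 * q" by auto
  have w0: "w 0 \<ge> 1" using w_pos by simp
  have eq: "(W - 1) div w 0 = q"
    using w0 unfolding W q by (intro div_nat_eqI) (simp_all add: algebra_simps)
  show ?thesis unfolding v_deg_def eq q ..
qed

text \<open>The quotient \<open>(W - 1) div w n\<close> is itself the least \<open>m\<close>. It
  qualifies because \<open>W - 1 - w n = ?S + w 0 - 1 \<ge> ?S\<close>. It is minimal because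
  \<open>?S\<close> and \<open>m * w n\<close> are both multiples of \<open>w 0\<close>: a strict
  inequality between them leaves a gap of at least \<open>w 0\<close>, whence
  \<open>W \<le> (m + 1) * w n\<close>.\<close>

lemma v_deg_n:
  assumes "n \<ge> 1"
  shows "v_deg n = (LEAST m. m * w n > (\<Sum>i=1..n-1. w i)) * w n + 1"
proof -
  let ?S = "\<Sum>i=1..n-1. w i"
  define M where "M = (W - 1) div w n"
  have wn: "w n \<ge> 1" and w0: "w 0 \<ge> 1" using w_pos by simp_all
  have W: "W = w 0 + ?S + w n"
  proof -
    obtain n' where n': "n = Suc n'" using assms by (cases n) auto
    have "(\<Sum>i\<le>Suc n'. w i) = w 0 + (\<Sum>i=1..n'. w i) + w (Suc n')"
      by (simp add: atMost_atLeast0 sum.atLeast_Suc_atMost)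
    then show ?thesis unfolding W_def using n' by simp
  qed
  have "(LEAST m. m * w n > ?S) = M"
  proof (rule Least_equality)
    have "W - 1 < M * w n + w n"
      unfolding M_def using wn by (metis add.commute dividend_less_div_times Suc_le_eq One_nat_def)
    then show "?S < M * w n" using W w0 by linarith
  next
    fix m assume m: "?S < m * w n"
    have "w 0 dvd m * w n" "w 0 dvd ?S" by (auto intro!: dvd_sum w_dvd dvd_mult)
    then obtain p q where pq: "m * w n = w 0 * p" "?S = w 0 * q" by (metis dvdE)
    have "w 0 * q < w 0 * p" using m pq by simp
    then have "w 0 * (q + 1) \<le> w 0 * p" by (intro mult_le_mono) auto
    then have "W \<le> m * w n + w n" using W pq by (simp add: algebra_simps)
    then have "W - 1 < (m + 1) * w n" using W wn by (simp add: algebra_simps)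
    then have "M < m + 1" unfolding M_def by (rule less_mult_imp_div_less)
    then show "M \<le> m" by simp
  qed
  then show ?thesis by (simp add: v_deg_def M_def)
qed

end

section \<open>Hilbert functions and evaluation codes\<close>

text \<open>Over a finite field a dimension can be read off a cardinality, so the Hilbert function
  can be compared with the code by counting.\<close>

lemma (in vectorspace) card_carrier_eq_power_dim:
  assumes "finite (carrier K)" "finite (carrier V)"
  shows "card (carrier V) = card (carrier K) ^ dim"
proof -
  have "span (carrier V) = carrier V"
    using span_is_subset2[of "carrier V"] in_own_span[of "carrier V"] by auto
  then have "fin_dim" unfolding fin_dim_def using assms(2) by auto
  then obtain B where B: "finite B" "basis B" using finite_basis_exists by blast
  then have sub: "B \<subseteq> carrier V" by (simp add: basis_def)
  have uniq: "\<forall>v. v \<in> carrier V \<longrightarrow> (\<exists>!a. a \<in> B \<rightarrow>\<^sub>E carrier K \<and> lincomb a B = v)"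
    using basis_criterion[OF B(1) sub] B(2) by blast
  have closed: "lincomb a B \<in> carrier V" if "a \<in> B \<rightarrow>\<^sub>E carrier K" for a
    using that sub by (intro lincomb_closed) auto
  have "bij_betw (\<lambda>a. lincomb a B) (B \<rightarrow>\<^sub>E carrier K) (carrier V)"
    unfolding bij_betw_def inj_on_def
  proof (intro conjI ballI impI)
    fix a b assume "a \<in> B \<rightarrow>\<^sub>E carrier K" "b \<in> B \<rightarrow>\<^sub>E carrier K" "lincomb a B = lincomb b B"
    then show "a = b" using uniq closed by metis
  next
    show "(\<lambda>a. lincomb a B) ` (B \<rightarrow>\<^sub>E carrier K) = carrier V"
      using uniq closed by (auto simp: image_iff)
  qed
  then have "card (carrier V) = card (B \<rightarrow>\<^sub>E carrier K)" by (simp add: bij_betw_same_card)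
  then show ?thesis using dim_basis[OF B] B(1) by (simp add: card_funcsetE)
qed

context
  fixes n d :: nat and X :: "(nat \<Rightarrow> 'k::{field,finite}) set set"
  assumes X_fin: "finite X"
    and X_rep: "\<And>f. f \<in> hom_part n d \<Longrightarrow>
      f \<in> vanishing_ideal n X \<longleftrightarrow> (\<forall>P\<in>X. peval (std_rep P) f = 0)"
begin

text \<open>The cosets of the vanishing forms are exactly the fibres of the evaluation map on forms
  of degree \<open>d\<close>, so the quotient space has as many elements as there are codewords.
  Writing cosets as fibres \<open>cls f\<close> also makes the quotient operations computable on
  representatives.\<close>

lemma card_code: "card (UNIV :: 'k set) ^ hilbert_fun n X d = card (code n X d)"
proof -
  define S where "S = (hom_part n d :: 'k mpoly set)"
  define \<phi> where "\<phi> = (\<lambda>f. \<lambda>P\<in>X. peval (std_rep P) f)"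
  define cls where "cls f = {g \<in> S. \<phi> g = \<phi> f}" for f
  define V where "V = (poly_alg n :: ('k, 'k mpoly) module)\<lparr>carrier := S\<rparr>"
  define I where "I = vanishing_ideal n X \<inter> S"
  define Q where "Q = quotient_space V I"
  define sm where "sm c f = Poly_Mapping.single 0 c * f" for c :: 'k and f :: "'k mpoly"
  have S: "0 \<in> S" "f \<in> S \<Longrightarrow> g \<in> S \<Longrightarrow> f + g \<in> S" "f \<in> S \<Longrightarrow> sm c f \<in> S" for f g c
    by (auto simp: S_def sm_def hom_part_zero hom_part_add hom_part_smult)
  have S_diff: "f - g \<in> S" if "f \<in> S" "g \<in> S" for f g
  proof -
    have "sm (- 1) g = - g" by (simp add: sm_def single_uminus)
    then show ?thesis using S(2)[OF that(1) S(3)[OF that(2), of "- 1"]] by simp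
  qed
  have \<phi>_eq: "\<phi> f = \<phi> g \<longleftrightarrow> (\<forall>P\<in>X. peval (std_rep P) f = peval (std_rep P) g)" for f g
    by (auto simp: \<phi>_def fun_eq_iff restrict_def)
  have peval_diff: "peval x (f - g) = peval x f - peval x g" for x :: "nat \<Rightarrow> 'k" and f g
    using peval_add[of x "f - g" g] by simp
  have V_sel: "carrier V = S" "add V = (+)" "zero V = 0" "module.smult V = sm"
    by (simp_all add: V_def poly_alg_sel sm_def fun_eq_iff)
  have I_iff: "h \<in> I \<longleftrightarrow> h \<in> S \<and> (\<forall>P\<in>X. peval (std_rep P) h = 0)" for h
    using X_rep by (auto simp: I_def S_def)
  have coset: "I +>\<^bsub>V\<^esub> f = cls f" if f: "f \<in> S" for f
  proof
    show "I +>\<^bsub>V\<^esub> f \<subseteq> cls f"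
      using f by (auto simp: a_r_coset_def' V_sel cls_def \<phi>_eq I_iff peval_add S)
    show "cls f \<subseteq> I +>\<^bsub>V\<^esub> f"
    proof
      fix g assume "g \<in> cls f"
      then have "g - f \<in> I" using f S_diff by (auto simp: I_iff cls_def \<phi>_eq peval_diff)
      then show "g \<in> I +>\<^bsub>V\<^esub> f" by (force simp: a_r_coset_def' V_sel)
    qed
  qed
  have cls_eq: "cls f = cls g \<longleftrightarrow> \<phi> f = \<phi> g" if "f \<in> S" "g \<in> S" for f g
    using that by (auto simp: cls_def)
  have carrier_Q: "carrier Q = cls ` S"
    using coset by (auto simp: Q_def quotient_space_def A_RCOSETS_def' V_sel)
  have add_Q: "cls f \<oplus>\<^bsub>Q\<^esub> cls g = cls (f + g)" if fg: "f \<in> S" "g \<in> S" for f g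
  proof
    show "cls f \<oplus>\<^bsub>Q\<^esub> cls g \<subseteq> cls (f + g)"
      by (auto simp: Q_def quotient_space_def set_add_def' V_sel cls_def \<phi>_eq peval_add S)
    show "cls (f + g) \<subseteq> cls f \<oplus>\<^bsub>Q\<^esub> cls g"
    proof
      fix h assume h: "h \<in> cls (f + g)"
      then have "h - f \<in> cls g" "f \<in> cls f"
        using fg S_diff by (auto simp: cls_def \<phi>_eq peval_diff peval_add)
      moreover have "h = f + (h - f)" by simp
      ultimately show "h \<in> cls f \<oplus>\<^bsub>Q\<^esub> cls g"
        unfolding Q_def quotient_space_def
        by (simp add: set_add_def' V_sel, rule_tac bexI[of _ f], rule_tac bexI[of _ "h - f"]) auto
    qed
  qed
  have smult_Q: "c \<odot>\<^bsub>Q\<^esub> cls f = cls (sm c f)" if f: "f \<in> S" for c f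
  proof -
    \<comment> \<open>The scalar action of \<open>quotient_space\<close> is a union over all
      representatives; every set in that union is the same fibre.\<close>
    have "I +>\<^bsub>V\<^esub> sm c g = cls (sm c f)" if "g \<in> cls f" for g
    proof -
      have g: "g \<in> S" "\<phi> g = \<phi> f" using that by (simp_all add: cls_def)
      then have "\<phi> (sm c g) = \<phi> (sm c f)" by (simp add: \<phi>_eq sm_def peval_smult)
      then show ?thesis using coset[OF S(3)[OF g(1)]] by (simp add: cls_def)
    qed
    moreover have "f \<in> cls f" using f by (simp add: cls_def)
    moreover have "c \<odot>\<^bsub>Q\<^esub> cls f = (\<Union>g\<in>cls f. I +>\<^bsub>V\<^esub> sm c g)"
      by (simp add: Q_def quotient_space_def V_sel)
    ultimately show ?thesis by blast
  qed
  have zero_Q: "\<zero>\<^bsub>Q\<^esub> = cls 0"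
    by (auto simp: Q_def quotient_space_def cls_def \<phi>_eq I_iff)
  have sm: "sm c (f + g) = sm c f + sm c g" "sm (c + e) f = sm c f + sm e f"
    "sm (c * e) f = sm c (sm e f)" "sm 1 f = f" for c e f g
    by (simp_all add: sm_def ring_distribs single_add mult_single flip: mult.assoc)
  have vs: "vectorspace class_ring Q"
  proof (rule vs_criteria)
    show "\<forall>v\<in>carrier Q. \<exists>u\<in>carrier Q. v \<oplus>\<^bsub>Q\<^esub> u = \<zero>\<^bsub>Q\<^esub>"
    proof
      fix v assume "v \<in> carrier Q"
      then obtain f where f: "f \<in> S" "v = cls f" by (auto simp: carrier_Q)
      have "0 - f \<in> S" using f S S_diff by blast
      then show "\<exists>u\<in>carrier Q. v \<oplus>\<^bsub>Q\<^esub> u = \<zero>\<^bsub>Q\<^esub>"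
        using f add_Q[of f "0 - f"] by (auto simp: carrier_Q zero_Q)
    qed
  qed (auto simp: carrier_Q zero_Q add_Q smult_Q S sm class_field add_ac class_ring_simps)
  interpret Q: vectorspace class_ring Q by (rule vs)
  have "bij_betw (\<lambda>c. {f \<in> S. \<phi> f = c}) (\<phi> ` S) (carrier Q)"
  proof (rule bij_betw_imageI)
    show "inj_on (\<lambda>c. {f \<in> S. \<phi> f = c}) (\<phi> ` S)" by (rule inj_onI) blast
    show "(\<lambda>c. {f \<in> S. \<phi> f = c}) ` \<phi> ` S = carrier Q"
      by (simp add: carrier_Q image_image cls_def[abs_def])
  qed
  then have card: "card (carrier Q) = card (\<phi> ` S)" and "finite (carrier Q) = finite (\<phi> ` S)"
    by (auto simp: bij_betw_same_card bij_betw_finite)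
  moreover have "finite (\<phi> ` S)"
    by (rule finite_subset[of _ "X \<rightarrow>\<^sub>E UNIV"]) (auto simp: \<phi>_def X_fin finite_PiE)
  ultimately have "card (carrier Q) = card (UNIV :: 'k set) ^ Q.dim"
    using Q.card_carrier_eq_power_dim by simp
  then show ?thesis
    using card unfolding hilbert_fun_def code_def Q_def V_def I_def S_def \<phi>_def by simp
qed

lemma hilbert_fun_eq_card_iff: "hilbert_fun n X d = card X \<longleftrightarrow> code n X d = X \<rightarrow>\<^sub>E UNIV"
proof -
  have one: "1 < card (UNIV :: 'k set)"
    using card_mono[of UNIV "{0 :: 'k, 1}"] by simp
  have fin: "finite (X \<rightarrow>\<^sub>E (UNIV :: 'k set))" using X_fin by (simp add: finite_PiE)
  have sub: "code n X d \<subseteq> X \<rightarrow>\<^sub>E UNIV" by (auto simp: code_def)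
  have "hilbert_fun n X d = card X \<longleftrightarrow> card (UNIV :: 'k set) ^ hilbert_fun n X d = card (UNIV :: 'k set) ^ card X"
    using one by (simp add: power_inject_exp)
  also have "\<dots> \<longleftrightarrow> card (code n X d) = card (X \<rightarrow>\<^sub>E (UNIV :: 'k set))"
    using X_fin by (simp add: card_code card_funcsetE)
  also have "\<dots> \<longleftrightarrow> code n X d = X \<rightarrow>\<^sub>E UNIV"
    using card_subset_eq[OF fin sub] by auto
  finally show ?thesis .
qed

end

section \<open>Points of a nested product\<close>

text \<open>Scaling the vector by \<open>c\<close> multiplies the coefficient of degree
  \<open>e\<close> by \<open>c ^ e\<close>, so vanishing may be tested on one representative of each
  point.\<close>

lemma hom_eval_scale:
  assumes "f \<in> carrier (poly_alg n)" "c \<noteq> 0"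
  shows "hom_eval (\<lambda>i. c * x i) f = 0 \<longleftrightarrow> hom_eval x f = 0"
proof -
  have "peval (\<lambda>i. c * x i) (hcomp e f) = c ^ e * peval x (hcomp e f)" for e
    by (rule hom_fun_scale[OF hom_funI[OF hcomp_hom_part[OF assms(1)] refl]])
  then show ?thesis using assms(2) by (simp add: poly_eq_iff coeff_hom_eval)
qed

lemma proj_point_self: "x \<in> proj_point x"
  unfolding proj_point_def by (auto intro!: exI[of _ 1])

lemma vanishing_ideal_proj_points:
  "vanishing_ideal n (proj_point ` S) = {f \<in> carrier (poly_alg n). \<forall>x\<in>S. hom_eval x f = 0}"
  unfolding vanishing_ideal_eq using proj_point_self by (auto simp: hom_eval_scale proj_point_def)

context subfield_tower
begin

definition std_pts :: "(nat \<Rightarrow> 'k) set" where "std_pts = (\<Union>k\<le>n. std_vecs k)"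

lemma std_vecs_multiple:
  assumes "x \<in> std_vecs k" "y \<in> std_vecs l" "x = (\<lambda>i. c * y i)"
  shows "x = y"
proof -
  have c: "c * y k = 1" using assms by (auto simp: std_vecs_def fun_eq_iff)
  then have kl: "\<not> k < l" and xl: "x l = c" "x l \<noteq> 0" using assms by (auto simp: std_vecs_def)
  have "\<not> l < k" using xl(2) assms(1) by (auto simp: std_vecs_def)
  then have "k = l" using kl by simp
  then show ?thesis using c assms by (auto simp: std_vecs_def)
qed

lemma proj_point_inj: "inj_on proj_point std_pts"
proof (rule inj_onI)
  fix x y assume xy: "x \<in> std_pts" "y \<in> std_pts" "proj_point x = proj_point y"
  then have "x \<in> proj_point y" using proj_point_self by metis
  then obtain c where "x = (\<lambda>i. c * y i)" by (auto simp: proj_point_def)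
  then show "x = y" using xy(1,2) by (auto simp: std_pts_def intro: std_vecs_multiple)
qed

lemma std_rep_proj_point:
  assumes "x \<in> std_vecs k"
  shows "std_rep (proj_point x) = x"
proof -
  have Least: "(LEAST i. c * x i \<noteq> 0) = k" if "c \<noteq> 0" for c
  proof (rule Least_equality)
    show "c * x k \<noteq> 0" using assms that by (simp add: std_vecs_def)
    show "k \<le> i" if "c * x i \<noteq> 0" for i
      using assms that by (cases "i < k") (auto simp: std_vecs_def)
  qed
  show ?thesis unfolding std_rep_def
  proof (rule the_equality)
    have "x (LEAST i. x i \<noteq> 0) = 1" using assms Least[of 1] by (simp add: std_vecs_def)
    then show "x \<in> proj_point x \<and> x (LEAST i. x i \<noteq> 0) = 1" by (simp add: proj_point_self)
    fix z assume z: "z \<in> proj_point x \<and> z (LEAST i. z i \<noteq> 0) = 1"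
    then obtain c where c: "c \<noteq> 0" "z = (\<lambda>i. c * x i)" by (auto simp: proj_point_def)
    then have "c * x k = 1" using z Least[OF c(1)] by simp
    then show "z = x" using c assms by (simp add: std_vecs_def)
  qed
qed

text \<open>Dividing by the leading entry stays in the grid: that entry lies in \<open>F k\<close>,
  which is contained in every later \<open>F i\<close>, and the earlier coordinates are
  zero.\<close>

lemma grid_normalise:
  assumes a: "a \<in> grid" "a \<noteq> (\<lambda>i. 0)"
  obtains y c where "y \<in> std_pts" "c \<noteq> 0" "a = (\<lambda>i. c * y i)"
proof -
  define k where "k = (LEAST i. a i \<noteq> 0)"
  obtain i where "a i \<noteq> 0" using a(2) by auto
  then have k: "a k \<noteq> 0" unfolding k_def by (rule LeastI)
  have k0: "a i = 0" if "i < k" for i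
    using not_less_Least[of i "\<lambda>i. a i \<noteq> 0"] that by (simp add: k_def)
  have kn: "k \<le> n"
  proof (rule ccontr)
    assume "\<not> k \<le> n"
    then have "a k = 0" using a(1) by (simp add: grid_def)
    then show False using k by simp
  qed
  define y where "y = (\<lambda>i. inverse (a k) * a i)"
  have "y i \<in> F i" if "i \<le> n" for i
  proof (cases "i < k")
    case True
    then show ?thesis using k0 F_closed(1)[OF that] by (simp add: y_def)
  next
    case False
    then have "a k \<in> F i" using tower[of k i] a(1) kn that by (auto simp: grid_def)
    then show ?thesis
      unfolding y_def using a(1) that by (intro F_closed(4,6)[OF that]) (auto simp: grid_def)
  qed
  then have "y \<in> std_vecs k" using a(1) k k0 by (auto simp: std_vecs_def grid_def y_def)
  then have "y \<in> std_pts" using kn by (auto simp: std_pts_def)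
  moreover have "a = (\<lambda>i. a k * y i)" using k by (simp add: y_def fun_eq_iff)
  ultimately show ?thesis using that k by blast
qed

lemma nested_product_eq: "nested_product n F = proj_point ` std_pts"
proof (intro equalityI subsetI)
  fix P assume "P \<in> nested_product n F"
  then obtain x a where x: "\<forall>i>n. x i = 0" "\<exists>i\<le>n. x i \<noteq> 0" "P = proj_point x"
    and a: "a \<in> P" "\<forall>i\<le>n. a i \<in> F i"
    by (auto simp: nested_product_def proj_space_def)
  obtain c where c: "c \<noteq> 0" "a = (\<lambda>i. c * x i)" using a(1) x(3) by (auto simp: proj_point_def)
  have "a \<in> grid" "a \<noteq> (\<lambda>i. 0)" using a(2) x c by (auto simp: grid_def fun_eq_iff)
  then obtain y e where y: "y \<in> std_pts" "e \<noteq> 0" "a = (\<lambda>i. e * y i)" by (rule grid_normalise)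
  have xi: "x i = (inverse c * e) * y i" for i
    using c y(2) fun_cong[OF y(3), of i] by (simp add: field_simps)
  then have xy: "x = (\<lambda>i. (inverse c * e) * y i)" by blast
  have "proj_point x = proj_point y"
  proof (intro equalityI subsetI)
    fix z assume "z \<in> proj_point x"
    then obtain b where "b \<noteq> 0" "z = (\<lambda>i. b * x i)" by (auto simp: proj_point_def)
    then show "z \<in> proj_point y"
      using c y(2) unfolding proj_point_def xy
      by (auto intro!: exI[of _ "b * (inverse c * e)"] simp: mult_ac)
  next
    fix z assume "z \<in> proj_point y"
    then obtain b where b: "b \<noteq> 0" "z = (\<lambda>i. b * y i)" by (auto simp: proj_point_def)
    then have "z i = (b * (c * inverse e)) * x i" for i using c y(2) by (simp add: xi field_simps)
    then have "z = (\<lambda>i. (b * (c * inverse e)) * x i)" by blast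
    then show "z \<in> proj_point x"
      unfolding proj_point_def using b c y(2)
      by (intro CollectI exI[of _ "b * (c * inverse e)"]) simp
  qed
  then show "P \<in> proj_point ` std_pts" using y(1) x(3) by blast
next
  fix P assume "P \<in> proj_point ` std_pts"
  then obtain x k where x: "P = proj_point x" "x \<in> std_vecs k" "k \<le> n" by (auto simp: std_pts_def)
  have "x k \<noteq> 0" "\<forall>i>n. x i = 0" "\<forall>i\<le>n. x i \<in> F i" using x(2) by (auto simp: std_vecs_def grid_def)
  moreover from this have "P \<in> proj_space n" unfolding proj_space_def x(1) using x(3) by blast
  moreover have "x \<in> P" by (simp add: x(1) proj_point_self)
  ultimately show "P \<in> nested_product n F" unfolding nested_product_def by blast
qed

lemma std_pts_finite: "finite std_pts"
  by (rule finite_subset[OF _ finite_set_of_finite_funs[of "{..n}" UNIV 0]])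
    (auto simp: std_pts_def std_vecs_def grid_def)

text \<open>Homogeneity spreads zeros from standard representatives to all their multiples, and
  every nonzero grid vector is such a multiple.\<close>

lemma indicator_deg_iff:
  assumes x: "x \<in> std_pts"
  shows "indicator_deg d x \<longleftrightarrow>
    (\<exists>f\<in>hom_part n d. peval x f \<noteq> 0 \<and> (\<forall>y\<in>std_pts - {x}. peval y f = 0))"
proof
  assume "indicator_deg d x"
  then obtain f where f: "f \<in> hom_part n d" "peval x f \<noteq> 0"
    "\<And>a. a \<in> grid \<Longrightarrow> (\<nexists>c. a = (\<lambda>i. c * x i)) \<Longrightarrow> peval a f = 0"
    unfolding indicator_deg_def by (auto elim!: hom_funE)
  moreover have "y \<in> grid" "\<nexists>c. y = (\<lambda>i. c * x i)" if "y \<in> std_pts - {x}" for y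
    using that x std_vecs_multiple[of y _ x] by (auto simp: std_pts_def std_vecs_def)
  ultimately show "\<exists>f\<in>hom_part n d. peval x f \<noteq> 0 \<and> (\<forall>y\<in>std_pts - {x}. peval y f = 0)"
    by blast
next
  assume "\<exists>f\<in>hom_part n d. peval x f \<noteq> 0 \<and> (\<forall>y\<in>std_pts - {x}. peval y f = 0)"
  then obtain f where f: "f \<in> hom_part n d" "peval x f \<noteq> 0" "\<And>y. y \<in> std_pts - {x} \<Longrightarrow> peval y f = 0"
    by blast
  have "peval a f = 0" if a: "a \<in> grid" "\<nexists>c. a = (\<lambda>i. c * x i)" for a
  proof -
    have "a \<noteq> (\<lambda>i. 0)" using a(2) by (auto dest: spec[of _ 0])
    then obtain y c where y: "y \<in> std_pts" "c \<noteq> 0" "a = (\<lambda>i. c * y i)"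
      using grid_normalise[OF a(1)] by blast
    then have "y \<noteq> x" using a(2) by blast
    then show ?thesis
      using y f(3)[of y] by (simp add: hom_fun_scale[OF hom_funI[OF f(1) refl]])
  qed
  then show "indicator_deg d x"
    unfolding indicator_deg_def using f(1,2) by (intro bexI[of _ "\<lambda>x. peval x f"] hom_funI) auto
qed

section \<open>Colon ideals and local v-numbers\<close>

lemma separating_linear_form:
  assumes "x \<in> std_pts" "y \<in> std_pts" "x \<noteq> y"
  shows "\<exists>g\<in>hom_part n 1. peval x g = 0 \<and> peval y g \<noteq> 0"
proof -
  obtain k l where k: "k \<le> n" "x \<in> std_vecs k" and l: "l \<le> n" "y \<in> std_vecs l"
    using assms by (auto simp: std_pts_def)
  \<comment> \<open>As \<open>x k = 1\<close>, each form \<open>t_i - x_i t_k\<close> vanishes at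
    \<open>x\<close>. If all of them vanished at \<open>y\<close> too, then \<open>y\<close> would
    be a multiple of \<open>x\<close>, and proportional standard vectors coincide.\<close>
  have "\<exists>i. y i \<noteq> y k * x i"
    using std_vecs_multiple[OF l(2) k(2), of "y k"] assms(3) by blast
  then obtain i where i: "y i \<noteq> y k * x i" by blast
  have "i \<le> n"
  proof (rule ccontr)
    assume "\<not> i \<le> n"
    then have "x i = 0" "y i = 0" using k l by (auto simp: std_vecs_def grid_def)
    then show False using i by simp
  qed
  then have "(\<lambda>a :: nat \<Rightarrow> 'k. a i + (- x i) * a k) \<in> hom_fun n 1"
    using k(1) by (intro hom_fun_add hom_fun_smult hom_fun_coord)
  then obtain g where g: "g \<in> hom_part n 1" "(\<lambda>a. a i + (- x i) * a k) = (\<lambda>a. peval a g)"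
    by (rule hom_funE)
  have "peval x g = 0" "peval y g \<noteq> 0"
    using fun_cong[OF g(2), of x] fun_cong[OF g(2), of y] i k by (auto simp: std_vecs_def mult.commute)
  then show ?thesis using g(1) by blast
qed

text \<open>\<open>hom_eval\<close> is multiplicative with values in a domain, so the colon ideal
  consists of the polynomials vanishing at every point where \<open>f\<close> does not. If it is the
  ideal of \<open>x\<close>, a linear form separating \<open>x\<close> from \<open>y\<close> forces
  \<open>f\<close> to vanish at \<open>y\<close>, and the absence of 1 forces \<open>f\<close> to be
  nonzero somewhere, hence at \<open>x\<close>.\<close>

lemma colon_ideal_iff:
  assumes f: "f \<in> hom_part n d" and x: "x \<in> std_pts"
  shows "colon_ideal n (vanishing_ideal n (nested_product n F)) f = vanishing_ideal n {proj_point x}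
    \<longleftrightarrow> peval x f \<noteq> 0 \<and> (\<forall>y\<in>std_pts - {x}. peval y f = 0)"
proof -
  have fc: "f \<in> carrier (poly_alg n)" using f by (simp add: hom_part_def)
  have hf: "hom_eval y f = 0 \<longleftrightarrow> peval y f = 0" for y
    by (simp add: hom_eval_hom_part[OF f])
  have L: "colon_ideal n (vanishing_ideal n (nested_product n F)) f =
    {g \<in> carrier (poly_alg n). \<forall>y\<in>std_pts. hom_eval y g = 0 \<or> peval y f = 0}"
    using fc by (auto simp: colon_ideal_def nested_product_eq vanishing_ideal_proj_points
        carrier_mult hom_eval_mult hf)
  have R: "vanishing_ideal n {proj_point x} = {g \<in> carrier (poly_alg n). hom_eval x g = 0}"
    using vanishing_ideal_proj_points[of n "{x}"] by simp
  show ?thesis unfolding L R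
  proof
    assume eq: "{g \<in> carrier (poly_alg n). \<forall>y\<in>std_pts. hom_eval y g = 0 \<or> peval y f = 0} =
      {g \<in> carrier (poly_alg n). hom_eval x g = 0}"
    have *: "peval y f = 0" if y: "y \<in> std_pts - {x}" for y
    proof -
      obtain g where g: "g \<in> hom_part n 1" "peval x g = 0" "peval y g \<noteq> 0"
        using separating_linear_form[OF x] y by blast
      then have "g \<in> {g \<in> carrier (poly_alg n). hom_eval x g = 0}"
        by (simp add: hom_eval_hom_part) (simp add: hom_part_def)
      then have "hom_eval y g = 0 \<or> peval y f = 0" using y unfolding eq[symmetric] by blast
      then show ?thesis using g by (simp add: hom_eval_hom_part)
    qed
    have "hom_eval y 1 \<noteq> 0" for y :: "nat \<Rightarrow> 'k"
      using hom_eval_hom_part[OF hom_part_single[of 0 n 0 1], of y] peval_single[of y 0 1]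
      by simp
    then have "1 \<notin> {g \<in> carrier (poly_alg n). hom_eval x g = 0}" by simp
    then have "\<exists>y\<in>std_pts. peval y f \<noteq> 0"
      unfolding eq[symmetric] using carrier_one by blast
    then show "peval x f \<noteq> 0 \<and> (\<forall>y\<in>std_pts - {x}. peval y f = 0)" using * by blast
  qed (use x in auto)
qed

lemma v_number_eq:
  assumes "n \<ge> 1" "k \<le> n" "x \<in> std_vecs k"
  shows "v_number n (nested_product n F) (proj_point x) = v_deg k"
proof -
  have x: "x \<in> std_pts" using assms by (auto simp: std_pts_def)
  have "v_number n (nested_product n F) (proj_point x) = (LEAST d. indicator_deg d x)"
    unfolding v_number_def by (simp add: colon_ideal_iff[OF _ x] indicator_deg_iff[OF x] cong: bex_cong)
  also have "\<dots> = v_deg k"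
    using indicator_deg_v_deg[OF assms(2,3)] v_deg_le[OF assms] by (intro Least_equality)
  finally show ?thesis .
qed

section \<open>The minimum distance function\<close>

lemma min_dist_eq_1_iff:
  "min_dist n (nested_product n F) d = 1 \<longleftrightarrow> (\<exists>x\<in>std_pts. indicator_deg d x)"
proof -
  define supp where "supp f = {y \<in> std_pts. peval y f \<noteq> 0}" for f
  have rep: "std_rep (proj_point x) = x" if "x \<in> std_pts" for x
    using that std_rep_proj_point by (auto simp: std_pts_def)
  have card: "card {P \<in> nested_product n F. (\<lambda>P\<in>nested_product n F. peval (std_rep P) f) P \<noteq> 0} =
    card (supp f)" for f
  proof -
    have "{P \<in> nested_product n F. (\<lambda>P\<in>nested_product n F. peval (std_rep P) f) P \<noteq> 0} =
      proj_point ` supp f"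
      by (auto simp: nested_product_eq supp_def rep)
    moreover have "inj_on proj_point (supp f)"
      using proj_point_inj by (rule inj_on_subset) (auto simp: supp_def)
    ultimately show ?thesis by (simp add: card_image)
  qed
  have nonzero: "(\<exists>P\<in>nested_product n F. (\<lambda>P\<in>nested_product n F. peval (std_rep P) f) P \<noteq> 0)
    \<longleftrightarrow> supp f \<noteq> {}" for f
    by (auto simp: nested_product_eq supp_def rep)
  define Q where "Q w \<longleftrightarrow> (\<exists>f\<in>hom_part n d. supp f \<noteq> {} \<and> w = card (supp f))" for w
  have md: "min_dist n (nested_product n F) d = (LEAST w. Q w)"
    unfolding min_dist_def code_def Q_def by (simp only: bex_simps nonzero card)
  \<comment> \<open>A nonzero codeword exists in every degree, since the \<open>d\<close>-th power
    of the last variable is 1 at \<open>unit_vec n\<close>. The minimum is thus attained, and being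
    at least 1 it equals 1 exactly when some codeword has weight 1.\<close>
  have "\<exists>w. Q w"
  proof -
    have "(\<lambda>x :: nat \<Rightarrow> 'k. x n ^ d) \<in> hom_fun n (d * 1)" by (intro hom_fun_power hom_fun_coord order_refl)
    then obtain f where f: "f \<in> hom_part n d" "(\<lambda>x :: nat \<Rightarrow> 'k. x n ^ d) = (\<lambda>x. peval x f)"
      by (auto elim: hom_funE)
    have "unit_vec n \<in> supp f"
      using fun_cong[OF f(2), of "unit_vec n"] unit_vec_std[of n]
      by (auto simp: supp_def std_pts_def unit_vec_def)
    then show ?thesis unfolding Q_def using f(1) by blast
  qed
  moreover have "w \<ge> 1" if "Q w" for w
  proof -
    have "finite (supp f)" for f using std_pts_finite by (simp add: supp_def)
    then show ?thesis using that by (auto simp: Q_def Suc_le_eq card_gt_0_iff)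
  qed
  ultimately have "(LEAST w. Q w) = 1 \<longleftrightarrow> Q 1"
    by (metis LeastI_ex Least_equality)
  also have "Q 1 \<longleftrightarrow> (\<exists>f\<in>hom_part n d. \<exists>x. supp f = {x})"
    unfolding Q_def by (metis card_1_singletonE insert_not_empty is_singletonI is_singleton_altdef)
  also have "\<dots> \<longleftrightarrow> (\<exists>x\<in>std_pts. indicator_deg d x)"
  proof -
    have "supp f = {x} \<longleftrightarrow> x \<in> std_pts \<and> peval x f \<noteq> 0 \<and> (\<forall>y\<in>std_pts - {x}. peval y f = 0)" for f x
      by (auto simp: supp_def)
    then show ?thesis using indicator_deg_iff by auto
  qed
  finally show ?thesis by (simp add: md)
qed

lemma reg_min_dist_eq:
  assumes "n \<ge> 1"
  shows "reg_min_dist n (nested_product n F) = v_deg n"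
  unfolding reg_min_dist_def min_dist_eq_1_iff
proof (rule Least_equality)
  show "\<exists>x\<in>std_pts. indicator_deg (v_deg n) x"
    using indicator_deg_v_deg[OF order_refl unit_vec_std] unit_vec_std by (auto simp: std_pts_def)
  fix d assume "\<exists>x\<in>std_pts. indicator_deg d x"
  then obtain x k where "k \<le> n" "x \<in> std_vecs k" "indicator_deg d x" by (auto simp: std_pts_def)
  then show "v_deg n \<le> d"
    using v_deg_le[OF assms] v_deg_antimono[of k n] by (meson le_trans order_refl)
qed

section \<open>The Hilbert function\<close>

lemma hilbert_fun_eq_iff:
  "hilbert_fun n (nested_product n F) d = card (nested_product n F) \<longleftrightarrow>
    (\<forall>x\<in>std_pts. indicator_deg d x)"
proof -
  let ?X = "nested_product n F"
  have rep: "std_rep (proj_point x) = x" if "x \<in> std_pts" for x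
    using that std_rep_proj_point by (auto simp: std_pts_def)
  have "f \<in> vanishing_ideal n ?X \<longleftrightarrow> (\<forall>P\<in>?X. peval (std_rep P) f = 0)" if f: "f \<in> hom_part n d" for f
    using f by (auto simp: nested_product_eq vanishing_ideal_proj_points hom_eval_hom_part rep)
      (auto simp: hom_part_def)
  moreover have "finite ?X" by (simp add: nested_product_eq std_pts_finite)
  ultimately have "hilbert_fun n ?X d = card ?X \<longleftrightarrow> code n ?X d = ?X \<rightarrow>\<^sub>E UNIV"
    by (rule hilbert_fun_eq_card_iff[rotated])
  also have "\<dots> \<longleftrightarrow> (\<forall>x\<in>std_pts. indicator_deg d x)"
  proof
    assume full: "code n ?X d = ?X \<rightarrow>\<^sub>E UNIV"
    show "\<forall>x\<in>std_pts. indicator_deg d x"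
    proof
      fix x assume x: "x \<in> std_pts"
      \<comment> \<open>A form whose codeword is the unit vector at a point is an indicator of that
        point.\<close>
      have "(\<lambda>P\<in>?X. if P = proj_point x then 1 else 0) \<in> code n ?X d" by (simp add: full)
      then obtain f where f: "f \<in> hom_part n d"
        "(\<lambda>P\<in>?X. if P = proj_point x then 1 else 0) = (\<lambda>P\<in>?X. peval (std_rep P) f)"
        by (auto simp: code_def)
      have "peval y f = (if y = x then 1 else 0)" if y: "y \<in> std_pts" for y
        using fun_cong[OF f(2), of "proj_point y"] y x rep[OF y] inj_onD[OF proj_point_inj, of y x]
        by (auto simp: nested_product_eq split: if_splits)
      then show "indicator_deg d x"
        unfolding indicator_deg_iff[OF x] using f(1) x by (intro bexI[of _ f]) auto
    qed
  next
    assume "\<forall>x\<in>std_pts. indicator_deg d x"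
    then have "\<forall>x\<in>std_pts. \<exists>f\<in>hom_part n d. peval x f \<noteq> 0 \<and> (\<forall>y\<in>std_pts - {x}. peval y f = 0)"
      using indicator_deg_iff by blast
    then obtain f where f: "\<And>x. x \<in> std_pts \<Longrightarrow> f x \<in> hom_part n d \<and> peval x (f x) \<noteq> 0 \<and>
        (\<forall>y\<in>std_pts - {x}. peval y (f x) = 0)"
      by metis
    show "code n ?X d = ?X \<rightarrow>\<^sub>E UNIV"
    proof (intro equalityI subsetI)
      fix c :: "(nat \<Rightarrow> 'k) set \<Rightarrow> 'k" assume c: "c \<in> ?X \<rightarrow>\<^sub>E UNIV"
      \<comment> \<open>Lagrange interpolation: the indicators are rescaled to take the prescribed
        values at their own points and added up.\<close>
      define g where "g = (\<Sum>x\<in>std_pts. Poly_Mapping.single 0 (c (proj_point x) / peval x (f x)) * f x)"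
      have "g \<in> hom_part n d" unfolding g_def using f by (intro hom_part_sum hom_part_smult) auto
      moreover have "peval y g = c (proj_point y)" if y: "y \<in> std_pts" for y
      proof -
        have "peval y g = (\<Sum>x\<in>std_pts. if x = y then c (proj_point y) else 0)"
          unfolding g_def peval_sum peval_smult using f y by (intro sum.cong) auto
        then show ?thesis using y std_pts_finite by simp
      qed
      then have "c = (\<lambda>P\<in>?X. peval (std_rep P) g)"
        using c rep by (intro ext) (auto simp: nested_product_eq restrict_def PiE_def extensional_def)
      ultimately show "c \<in> code n ?X d" unfolding code_def by blast
    qed (auto simp: code_def)
  qed
  finally show ?thesis .
qed

text \<open>All points must have indicators in every degree from some bound on. Indicator degrees
  are closed upwards, so the bound is the largest of the \<open>v_deg k\<close>, which is
  \<open>v_deg 0\<close> and is forced by \<open>unit_vec 0\<close>.\<close>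

lemma reg_hilbert_eq:
  assumes "n \<ge> 1"
  shows "reg_hilbert n (nested_product n F) = v_deg 0"
  unfolding reg_hilbert_def hilbert_fun_eq_iff
proof (rule Least_equality)
  show "\<forall>d\<ge>v_deg 0. \<forall>x\<in>std_pts. indicator_deg d x"
  proof (intro allI impI ballI)
    fix d x assume d: "v_deg 0 \<le> d" and "x \<in> std_pts"
    then obtain k where k: "k \<le> n" "x \<in> std_vecs k" by (auto simp: std_pts_def)
    have "v_deg k \<le> d" using v_deg_antimono[of 0 k] k d by simp
    then show "indicator_deg d x"
    proof (induction d rule: dec_induct)
      case base
      show ?case by (rule indicator_deg_v_deg[OF k])
    next
      case (step m)
      then show ?case using indicator_deg_Suc[OF k(1)] k(2) by (auto simp: std_vecs_def)
    qed
  qed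
  fix r assume "\<forall>d\<ge>r. \<forall>x\<in>std_pts. indicator_deg d x"
  then have "indicator_deg r (unit_vec 0)" using unit_vec_std[of 0] by (auto simp: std_pts_def)
  then show "v_deg 0 \<le> r" using v_deg_le[OF assms _ unit_vec_std] by simp
qed

end

theorem theorem4p10:
  fixes n :: nat and F :: "nat \<Rightarrow> 'k::{field,finite} set"
    and d :: "nat \<Rightarrow> nat" and m :: nat and X :: "(nat \<Rightarrow> 'k) set set"
  assumes "n \<ge> 1"
    and "\<And>i. i \<le> n \<Longrightarrow> subfield (F i) (class_ring :: 'k ring)"
    and "\<And>i. i < n \<Longrightarrow> F i \<subseteq> F (Suc i)"
  defines "d \<equiv> \<lambda>i. card (F i)"
    and "X \<equiv> nested_product n F"
    and "m \<equiv> (LEAST m. m * (d n - 1) > (\<Sum>i=1..n-1. (d i - 1)))"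
  shows "reg_min_dist n X = m * (d n - 1) + 1 \<and>
    (\<forall>P\<in>X. v_number n X P \<in> (\<lambda>j. v_number n X (unit_point j)) ` {0..n}) \<and>
    1 + (\<Sum>i=1..n. (d i - 1)) = reg_hilbert n X \<and>
    reg_hilbert n X = v_number n X (unit_point 0) \<and>
    (\<forall>j<n. v_number n X (unit_point j) \<ge> v_number n X (unit_point (Suc j))) \<and>
    v_number n X (unit_point n) = m * (d n - 1) + 1 \<and>
    m * (d n - 1) + 1 = reg_min_dist n X"
proof -
  interpret subfield_tower n F by (rule subfield_tower.intro) (fact assms)+
  have v_unit: "v_number n X (unit_point j) = v_deg j" if "j \<le> n" for j
    using v_number_eq[OF assms(1) that unit_vec_std[OF that]]
    by (simp add: X_def unit_point_def unit_vec_def)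
  have m: "v_deg n = m * (d n - 1) + 1"
    using v_deg_n[OF assms(1)] by (simp add: m_def d_def w_def)
  have "\<forall>P\<in>X. v_number n X P \<in> (\<lambda>j. v_number n X (unit_point j)) ` {0..n}"
  proof
    fix P assume "P \<in> X"
    then obtain x k where x: "P = proj_point x" "k \<le> n" "x \<in> std_vecs k"
      by (auto simp: X_def nested_product_eq std_pts_def)
    then have "v_number n X P = v_number n X (unit_point k)"
      using v_number_eq[OF assms(1)] v_unit by (simp add: X_def)
    then show "v_number n X P \<in> (\<lambda>j. v_number n X (unit_point j)) ` {0..n}" using x(2) by auto
  qed
  moreover have "reg_min_dist n X = v_deg n" "reg_hilbert n X = v_deg 0"
    using reg_min_dist_eq[OF assms(1)] reg_hilbert_eq[OF assms(1)] by (simp_all add: X_def)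
  moreover have "v_deg 0 = 1 + (\<Sum>i=1..n. (d i - 1))" using v_deg_0 by (simp add: w_def d_def)
  ultimately show ?thesis using v_unit v_deg_antimono m by simp
qed

end
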